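(* Consider the inequality $$R_{\mathcal{U},v}^{(p)}[1,N]\geq R_{\mathcal{U},v}^{(p)}[1,N'],\qquad (\ast)$$ where $1\leq N'\leq N$ are integers, $\mathcal{U}=(u_1,\ldots,u_N)$ is a finite sequence of vectors in $\mathbb{R}^n$ and $v\in\mathbb{S}^{n-1}$. (i) If $n=3$ and $0<p<1$, then $(\ast)$ holds for all such $N',N,\mathcal{U},v$. (ii) For every $n\geq 3$ and every $1<p<2$, there exist $N'\leq N$, $\mathcal{U}$ in $\mathbb{R}^n$ and $v\in\mathbb{S}^{n-1}$ for which $(\ast)$ fails. (iii) For every $n\geq 4$ and every $0<p<1$, there exist $N'\leq N$, $\mathcal{U}$ in $\mathbb{R}^n$ and $v\in\mathbb{S}^{n-1}$ for which $(\ast)$ fails.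
   Context: For a finite sequence $\mathcal{U}=(u_1,\ldots,u_N)$ in $\mathbb{R}^n$, $v\in\mathbb{S}^{n-1}$, $p>0$ and $1\leq a\leq b\leq N$, set $$R_{\mathcal{U},v}^{(p)}[a,b]=\frac{\displaystyle\sum_{M\subset\{a,\ldots,b\},\ |M|=n}|\det(u_m)_{m\in M}|^p}{\displaystyle\sum_{M\subset\{a,\ldots,b\},\ |M|=n-1}|\det(P_{v^\perp}u_m)_{m\in M}|^p}.$$ Here $P_{v^\perp}$ is the orthogonal projection onto $v^\perp$, and the projected determinant is computed in any orthonormal basis of $v^\perp$ (equivalently, its absolute value is the $(n-1)$-dimensional volume of the parallelotope spanned by the projected vectors). An empty sum is zero, and the ratio is defined to be $0$ when its denominator vanishes. *)

theory Defs
  imports Complex_Main "Jordan_Normal_Form.Schur_Decomposition"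
begin

definition unit_sphere :: "nat \<Rightarrow> real vec set" where
  "unit_sphere n = {v \<in> carrier_vec n. sqrt (v \<bullet> v) = 1}"

text \<open>Orthogonal projection onto the hyperplane orthogonal to \<open>v\<close>; meant for unit vectors \<open>v\<close>.\<close>

definition proj_perp :: "real vec \<Rightarrow> real vec \<Rightarrow> real vec" where
  "proj_perp v x = x - (v \<bullet> x) \<cdot>\<^sub>v v"

text \<open>
  For \<open>v \<noteq> 0\<close>, the orthogonal complement of \<open>v\<close> has dimension \<open>n - 1\<close>, so \<open>n - 1\<close> orthonormal vectors
  in it automatically form a basis.
\<close>

definition orthonormal_basis_perp :: "nat \<Rightarrow> real vec \<Rightarrow> real vec list \<Rightarrow> bool" where
  "orthonormal_basis_perp n v bs \<longleftrightarrow>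
     length bs = n - 1 \<and> set bs \<subseteq> carrier_vec n \<and>
     (\<forall>b \<in> set bs. v \<bullet> b = 0) \<and>
     (\<forall>i < n - 1. \<forall>j < n - 1. bs ! i \<bullet> bs ! j = (if i = j then 1 else 0))"

text \<open>The matrix of the coordinates of \<open>proj_perp v (ws ! j)\<close> in the orthonormal basis \<open>bs\<close>.\<close>

definition proj_coord_mat :: "nat \<Rightarrow> real vec \<Rightarrow> real vec list \<Rightarrow> real vec list \<Rightarrow> real mat" where
  "proj_coord_mat n v bs ws = mat (n - 1) (n - 1) (\<lambda>(i, j). bs ! i \<bullet> proj_perp v (ws ! j))"

text \<open>
  The basis is an arbitrary choice; \<open>orthonormal_basis_perp_exists\<close> and
  \<open>proj_abs_det_eq\<close> below show that it exists and does not matter.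
\<close>

definition proj_abs_det :: "nat \<Rightarrow> real vec \<Rightarrow> real vec list \<Rightarrow> real" where
  "proj_abs_det n v ws = \<bar>det (proj_coord_mat n v (SOME bs. orthonormal_basis_perp n v bs) ws)\<bar>"

text \<open>
  The sequence is given by its values \<open>u 1, u 2, \<dots>\<close>; only those with index in \<open>{a..b}\<close> matter.
  The library conventions \<open>x / 0 = 0\<close> and \<open>0 powr p = 0\<close> give the intended values when the
  denominator or a determinant vanishes.
\<close>

definition det_ratio :: "nat \<Rightarrow> (nat \<Rightarrow> real vec) \<Rightarrow> real vec \<Rightarrow> real \<Rightarrow> nat \<Rightarrow> nat \<Rightarrow> real" where
  "det_ratio n u v p a b =
     (\<Sum>M | M \<subseteq> {a..b} \<and> card M = n.
        \<bar>det (mat_of_cols n (map u (sorted_list_of_set M)))\<bar> powr p) /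
     (\<Sum>M | M \<subseteq> {a..b} \<and> card M = n - 1.
        proj_abs_det n v (map u (sorted_list_of_set M)) powr p)"

lemma orthonormal_basis_perp_exists:
  assumes v: "v \<in> unit_sphere n"
  shows "\<exists>bs. orthonormal_basis_perp n v bs"
proof -
  interpret cof_vec_space n "TYPE(real)" .
  have vc: "v \<in> carrier_vec n" and vv: "v \<bullet> v = 1"
    using v by (auto simp: unit_sphere_def)
  have v0: "v \<noteq> 0\<^sub>v n" using vc vv by auto
  have n0: "n \<noteq> 0" using vc vv by (cases n) (auto simp: scalar_prod_def)
  define b where "b = basis_completion v"
  note bc = basis_completion[OF vc v0, folded b_def]
  define ws where "ws = gram_schmidt n b"
  have gs: "set ws \<subseteq> carrier_vec n" "corthogonal ws" "length ws = n"
    using gram_schmidt_result[OF bc(2,4,5) ws_def] bc(6) by auto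
  from bc n0 obtain b' where b': "b = v # b'" by (cases b) auto
  have "set b' \<subseteq> carrier_vec n" using bc(2) b' by auto
  hence "hd ws = v" unfolding ws_def b' using gram_schmidt_hd[OF vc] by auto
  then obtain cs where ws: "ws = v # cs" using gs(3) n0 by (cases ws) auto
  have len: "length cs = n - 1" using gs(3) ws by auto
  have cc: "cs ! i \<in> carrier_vec n" if "i < n - 1" for i
    using gs(1) len that ws by (auto simp: subset_iff)
  have orth: "cs ! i \<bullet> cs ! j = 0 \<longleftrightarrow> i \<noteq> j" if "i < n - 1" "j < n - 1" for i j
    using corthogonalD[OF gs(2), of "Suc i" "Suc j"] that len by (auto simp: ws)
  have orthv: "v \<bullet> cs ! i = 0" if "i < n - 1" for i
    using corthogonalD[OF gs(2), of 0 "Suc i"] that len by (auto simp: ws)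
  have pos: "cs ! i \<bullet> cs ! i > 0" if "i < n - 1" for i
    using orth[OF that that] sum_nonneg[of "{0..<dim_vec (cs ! i)}" "\<lambda>k. cs ! i $ k * cs ! i $ k"]
    by (auto simp: scalar_prod_def less_le)
  define nz where "nz = (\<lambda>w :: real vec. (1 / sqrt (w \<bullet> w)) \<cdot>\<^sub>v w)"
  have "orthonormal_basis_perp n v (map nz cs)"
    unfolding orthonormal_basis_perp_def
  proof (intro conjI allI impI ballI)
    show "length (map nz cs) = n - 1" using len by simp
    show "set (map nz cs) \<subseteq> carrier_vec n" using gs(1) ws by (auto simp: nz_def)
  next
    fix x assume "x \<in> set (map nz cs)"
    then obtain i where i: "i < n - 1" "x = nz (cs ! i)" using len by (auto simp: in_set_conv_nth)
    show "v \<bullet> x = 0" using orthv[OF i(1)] cc[OF i(1)] vc i(2) by (simp add: nz_def)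
  next
    fix i j assume ij: "i < n - 1" "j < n - 1"
    have "map nz cs ! i \<bullet> map nz cs ! j
        = 1 / sqrt (cs ! i \<bullet> cs ! i) * (1 / sqrt (cs ! j \<bullet> cs ! j) * (cs ! i \<bullet> cs ! j))"
      using ij len cc[OF ij(1)] cc[OF ij(2)] by (simp add: nz_def)
    also have "\<dots> = (if i = j then 1 else 0)"
      using orth[OF ij] pos[OF ij(1)] by auto
    finally show "map nz cs ! i \<bullet> map nz cs ! j = (if i = j then 1 else 0)" .
  qed
  thus ?thesis by blast
qed

lemma det_proj_coord_mat:
  assumes v: "v \<in> unit_sphere n" and bs: "orthonormal_basis_perp n v bs"
    and ws: "set ws \<subseteq> carrier_vec n" and len: "length ws = n - 1"
  shows "\<bar>det (proj_coord_mat n v bs ws)\<bar> = \<bar>det (mat_of_cols n (v # map (proj_perp v) ws))\<bar>"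
proof -
  have vc: "v \<in> carrier_vec n" and vv: "v \<bullet> v = 1"
    using v by (auto simp: unit_sphere_def)
  have "n \<noteq> 0" using vc vv by (cases n) (auto simp: scalar_prod_def)
  then obtain k where n: "n = Suc k" by (cases n) auto
  note b = bs[unfolded orthonormal_basis_perp_def n]
  have bc: "bs ! i \<in> carrier_vec n" and bv: "bs ! i \<bullet> v = 0" if "i < k" for i
  proof -
    have m: "bs ! i \<in> set bs" using b that by auto
    show c: "bs ! i \<in> carrier_vec n" using b m n by auto
    show "bs ! i \<bullet> v = 0" using b m comm_scalar_prod[OF vc c] by auto
  qed
  have lenb: "length bs = k" using b by simp
  have wc: "ws ! j \<in> carrier_vec n" if "j < k" for j
    using ws len n that by (auto simp: subset_iff)
  have pc: "proj_perp v (ws ! j) \<in> carrier_vec n" and pv: "v \<bullet> proj_perp v (ws ! j) = 0"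
    if "j < k" for j
  proof -
    show "proj_perp v (ws ! j) \<in> carrier_vec n" using wc[OF that] vc by (simp add: proj_perp_def)
    have "v \<bullet> proj_perp v (ws ! j) = v \<bullet> (ws ! j) - (v \<bullet> (ws ! j)) * (v \<bullet> v)"
      unfolding proj_perp_def
      using wc[OF that] vc by (subst scalar_prod_minus_distrib[OF vc]) auto
    thus "v \<bullet> proj_perp v (ws ! j) = 0" using vv by simp
  qed
  define F where "F = mat_of_rows n (v # bs)"
  define C where "C = mat_of_cols n (v # map (proj_perp v) ws)"
  have F: "F \<in> carrier_mat n n" using lenb n by (simp add: F_def mat_of_rows_def)
  have C: "C \<in> carrier_mat n n" using len n by (simp add: C_def mat_of_cols_def)
  have rF: "row F i = (v # bs) ! i" if "i < n" for i
    unfolding F_def using that vc bc n lenb by (intro mat_of_rows_row) (auto simp: nth_Cons split: nat.split)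
  have cC: "col C j = (v # map (proj_perp v) ws) ! j" if "j < n" for j
    unfolding C_def using that vc pc n len by (intro col_mat_of_cols) (auto simp: nth_Cons split: nat.split)
  have vb: "v \<bullet> bs ! i = 0" if "i < k" for i
    using bv[OF that] comm_scalar_prod[OF vc bc[OF that]] by simp
  have "F * F\<^sup>T = 1\<^sub>m n"
  proof (rule eq_matI)
    fix i j assume "i < dim_row (1\<^sub>m n :: real mat)" "j < dim_col (1\<^sub>m n :: real mat)"
    hence ij: "i < n" "j < n" by auto
    have "(F * F\<^sup>T) $$ (i, j) = row F i \<bullet> row F j" using F ij by auto
    also have "\<dots> = 1\<^sub>m n $$ (i, j)"
      using ij b vv vb bv unfolding rF[OF ij(1)] rF[OF ij(2)] n
      by (cases i; cases j) auto
    finally show "(F * F\<^sup>T) $$ (i, j) = 1\<^sub>m n $$ (i, j)" .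
  qed (use F in auto)
  hence "det F * det F = 1"
    using det_mult[OF F transpose_carrier_mat[THEN iffD2, OF F]] det_transpose[OF F] by simp
  hence dF: "\<bar>det F\<bar> = 1" by (metis abs_1 abs_mult abs_ge_zero mult_cancel_left2 power2_eq_square power2_eq_1_iff abs_minus_cancel)
  have FC: "F * C = four_block_mat (1\<^sub>m 1) (0\<^sub>m 1 k) (0\<^sub>m k 1) (proj_coord_mat n v bs ws)"
    (is "_ = ?B")
  proof (rule eq_matI)
    fix i j assume "i < dim_row ?B" "j < dim_col ?B"
    hence ij: "i < n" "j < n" by (auto simp: n proj_coord_mat_def)
    have "(F * C) $$ (i, j) = row F i \<bullet> col C j" using F C ij by auto
    also have "\<dots> = ?B $$ (i, j)"
      using ij vv bv pv len n unfolding rF[OF ij(1)] cC[OF ij(2)]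
      by (cases i; cases j) (auto simp: proj_coord_mat_def)
    finally show "(F * C) $$ (i, j) = ?B $$ (i, j)" .
  qed (use F C n in \<open>auto simp: proj_coord_mat_def\<close>)
  have "det F * det C = det ?B" using det_mult[OF F C] FC by simp
  also have "\<dots> = det (proj_coord_mat n v bs ws)"
    by (subst det_four_block_mat_upper_right_zero[of _ 1 _ k])
       (auto simp: n proj_coord_mat_def)
  finally show ?thesis using dF unfolding C_def by (metis abs_mult mult_1)
qed

lemma proj_abs_det_eq:
  assumes "v \<in> unit_sphere n" and "orthonormal_basis_perp n v bs"
    and "set ws \<subseteq> carrier_vec n" and "length ws = n - 1"
  shows "proj_abs_det n v ws = \<bar>det (proj_coord_mat n v bs ws)\<bar>"
  using det_proj_coord_mat[OF assms]
    det_proj_coord_mat[OF assms(1) someI_ex[OF orthonormal_basis_perp_exists[OF assms(1)]] assms(3,4)]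
  unfolding proj_abs_det_def by simp

end

theory Submission
  imports Defs
begin

text \<open>
  Up to sign, the determinant of the projections of \<open>n - 1\<close> vectors is the determinant of these vectors
  together with \<open>v\<close>. Appending a vector \<open>w\<close> to the sequence therefore changes the ratio from \<open>A / D\<close> to
  \<open>(A + E) / (D + G)\<close>, where \<open>A\<close>, \<open>D\<close>, \<open>E\<close>, \<open>G\<close> are the sums of \<open>\<bar>det\<bar> powr p\<close> over the sets that are completed
  to \<open>n\<close> vectors by nothing, by \<open>v\<close>, by \<open>w\<close>, and by both. So monotonicity is the negative correlation
  inequality \<open>A * G \<le> D * E\<close>.

  For \<open>n = 3\<close> use coordinates in which \<open>v\<close> and \<open>w\<close> are the first two basis vectors. A vector \<open>(x, y, z)\<close> with
  \<open>z \<noteq> 0\<close> becomes the point \<open>(x / z, y / z)\<close> of the plane with mass \<open>\<bar>z\<bar> powr p\<close>. Then \<open>G\<close> is the total mass, \<open>D\<close> and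
  \<open>E\<close> collect the \<open>p\<close>-th powers of the coordinate differences of pairs of points, and \<open>A\<close> collects the \<open>p\<close>-th
  powers of the doubled areas of triangles. For \<open>p \<le> 1\<close> the power of an area is bounded by an expression that is bilinear
  in the powers of the horizontal and of the vertical differences (\<open>area_powr_le\<close>). The bound is
  chosen such that its sum over all triples turns \<open>A * G \<le> D * E\<close> into the statement that the distance covariance of
  the two coordinates is non-negative. This holds because \<open>\<bar>s - t\<bar> powr p\<close> is a constant minus a positive
  semidefinite kernel (\<open>concave_distance_kernel\<close>), so that distance covariance is a sum of squares
  (\<open>dist_cov_nonneg\<close>).

  The failures come from explicit configurations. For \<open>n = 3\<close> and \<open>1 < p < 2\<close>, the corners of a square give
  equality, and a light fifth point near a corner breaks the inequality (\<open>counterexample_dim_3\<close>).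
  For \<open>n = 4\<close>, six vectors with small integer determinants, three of them scaled, work for all \<open>0 < p < 2\<close>
  (\<open>counterexample_dim_4\<close>). A counterexample in dimension \<open>n\<close> yields one in dimension \<open>n + 1\<close> by adding a new
  basis vector at the front, which does not change either ratio (\<open>det_sum_ratio_lift\<close>).
\<close>

section \<open>Areas of triangles and powers of coordinate differences\<close>

text \<open>
  The graph of the concave function \<open>x powr p\<close> lies below its tangent at \<open>c\<close>; this follows from
  \<open>ln z \<le> z - 1\<close>, applied at two points whose weighted mean is \<open>1\<close>.
\<close>

lemma powr_le_tangent:
  fixes x c p :: real
  assumes "0 \<le> x" "0 < c" "0 < p" "p \<le> 1"
  shows "x powr p \<le> c powr p + p * (c powr p / c) * (x - c)"
proof (cases "x = 0")
  case True
  then show ?thesis using assms by (simp add: algebra_simps)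
next
  case False
  define z where "z = x / c"
  define y where "y = p * z + (1 - p)"
  have z: "z > 0" using False assms by (simp add: z_def)
  have y: "y > 0" using z assms by (simp add: y_def add_pos_nonneg)
  have "p * ln (z / y) + (1 - p) * ln (1 / y) \<le> p * (z / y - 1) + (1 - p) * (1 / y - 1)"
    using assms z y by (intro add_mono mult_left_mono ln_le_minus_one) auto
  also have "\<dots> = (p * z + (1 - p)) / y - 1"
    by (simp add: add_divide_distrib diff_divide_distrib algebra_simps)
  also have "\<dots> = y / y - 1" by (simp add: y_def)
  also have "\<dots> = 0" using y by simp
  finally have "p * ln z \<le> ln y" using z y by (simp add: ln_div algebra_simps)
  hence "z powr p \<le> y" using z y by (simp add: powr_def ln_ge_iff)
  hence "c powr p * z powr p \<le> c powr p * y" by (simp add: mult_left_mono)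
  also have "c powr p * z powr p = x powr p"
    using assms by (simp add: z_def powr_divide)
  also have "c powr p * y = c powr p + p * (c powr p / c) * (x - c)"
    using assms by (simp add: y_def z_def field_simps)
  finally show ?thesis .
qed

text \<open>
  Karamata's inequality for two points: \<open>m\<close> and \<open>a + b - m\<close> have the same sum as \<open>a\<close> and \<open>b\<close> but are
  farther apart, so a concave function has the smaller sum there. Compare with the tangents at \<open>a\<close> and \<open>b\<close>,
  of which the one at the larger point is less steep.
\<close>

lemma powr_spread_le:
  fixes a b m p :: real
  assumes "0 \<le> m" "m \<le> a" "m \<le> b" "0 < p" "p \<le> 1"
  shows "m powr p + (a + b - m) powr p \<le> a powr p + b powr p"
  using assms(2,3)
proof (induct a b rule: linorder_wlog)
  case (le a b)
  show ?case
  proof (cases "a = 0")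
    case True
    then show ?thesis using le assms by simp
  next
    case False
    hence a: "a > 0" and b: "b > 0" using le assms by auto
    define s where "s = (\<lambda>c::real. p * (c powr p / c))"
    have "m powr p \<le> a powr p + s a * (m - a)"
      unfolding s_def using assms a by (intro powr_le_tangent) auto
    moreover have "(a + b - m) powr p \<le> b powr p + s b * (a + b - m - b)"
      unfolding s_def using assms a b le by (intro powr_le_tangent) auto
    moreover have "s b \<le> s a"
      using mult_left_mono[OF powr_mono2'[of "p - 1" a b], of p] assms a b le
      by (simp add: s_def powr_diff)
    hence "s b * (a - m) \<le> s a * (a - m)" using le by (intro mult_right_mono) auto
    ultimately show ?thesis by (simp add: algebra_simps)
  qed
next
  case (sym a b)
  then show ?case by (simp add: add.commute)
qed

lemma powr_subadditive:
  fixes a b p :: real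
  assumes "0 \<le> a" "0 \<le> b" "0 < p" "p \<le> 1"
  shows "(a + b) powr p \<le> a powr p + b powr p"
  using powr_spread_le[of 0 a b p] assms by simp

text \<open>
  The arguments stand for the horizontal and vertical distances of three points, raised to the power \<open>p\<close>. Grouped by
  vertices, the sum is \<open>(b12 + b13 - b23) * a23\<close> plus the two analogous terms. If \<open>b\<close> is a sum of cut metrics
  on three points, then \<open>(b12 + b13 - b23) / 2\<close> is the total weight of the cuts that separate the first point
  from the other two. When the second coordinate is the indicator of such a cut, \<open>a23\<close> is exactly the \<open>p\<close>-th
  power of the doubled area. So half of the sum is what the area term would be if it were additive over cuts.
\<close>

definition cross_terms :: "real \<Rightarrow> real \<Rightarrow> real \<Rightarrow> real \<Rightarrow> real \<Rightarrow> real \<Rightarrow> real" where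
  "cross_terms a12 a13 a23 b12 b13 b23 =
     a12 * b13 + a13 * b12 + a12 * b23 + a23 * b12 + a13 * b23 + a23 * b13
     - a12 * b12 - a13 * b13 - a23 * b23"

text \<open>
  Here the middle vertex is between the other two in both coordinates. The doubled area is then the difference
  of the non-negative numbers \<open>p * s\<close> and \<open>q * r\<close>, hence at most their maximum, and each of the two alone is
  small enough: use that the longest side dominates the other two and that \<open>x powr e\<close> is subadditive.
\<close>

lemma area_powr_le_monotone:
  fixes p q r s e :: real
  assumes nn: "0 \<le> p" "0 \<le> q" "0 \<le> r" "0 \<le> s" and e: "0 < e" "e \<le> 1"
  shows "2 * \<bar>p * s - q * r\<bar> powr e
    \<le> cross_terms (p powr e) ((p + q) powr e) (q powr e) (r powr e) ((r + s) powr e) (s powr e)"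
proof -
  define P Q T R S W where d: "P = p powr e" "Q = q powr e" "T = (p + q) powr e"
    "R = r powr e" "S = s powr e" "W = (r + s) powr e"
  have pos: "0 \<le> P" "0 \<le> Q" "0 \<le> R" "0 \<le> S" by (simp_all add: d)
  have T: "P \<le> T" "Q \<le> T" and W: "R \<le> W" "S \<le> W"
    using nn e by (auto simp: d intro!: powr_mono2)
  have sub: "W \<le> R + S" using powr_subadditive[of r s e] nn e by (simp add: d)
  have X: "cross_terms P T Q R W S = (R + W - S) * Q + (W + S - R) * P + (R + S - W) * T"
    by (simp add: cross_terms_def algebra_simps)
  have 1: "2 * (P * S) \<le> cross_terms P T Q R W S"
  proof -
    have "0 \<le> (R + W - S) * Q" using pos W by simp
    moreover have "(R + S - W) * P \<le> (R + S - W) * T" using sub T by (intro mult_left_mono) auto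
    ultimately show ?thesis unfolding X by (simp add: algebra_simps)
  qed
  have 2: "2 * (Q * R) \<le> cross_terms P T Q R W S"
  proof -
    have "0 \<le> (W + S - R) * P" using pos W by simp
    moreover have "(R + S - W) * Q \<le> (R + S - W) * T" using sub T by (intro mult_left_mono) auto
    ultimately show ?thesis unfolding X by (simp add: algebra_simps)
  qed
  have "0 \<le> p * s" "0 \<le> q * r" using nn by auto
  hence "\<bar>p * s - q * r\<bar> \<le> p * s \<or> \<bar>p * s - q * r\<bar> \<le> q * r" by linarith
  hence "\<bar>p * s - q * r\<bar> powr e \<le> P * S \<or> \<bar>p * s - q * r\<bar> powr e \<le> Q * R"
    using e nn powr_mono2[of e "\<bar>p * s - q * r\<bar>" "p * s"] powr_mono2[of e "\<bar>p * s - q * r\<bar>" "q * r"]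
    by (auto simp: d powr_mult)
  with 1 2 have "2 * \<bar>p * s - q * r\<bar> powr e \<le> cross_terms P T Q R W S" by linarith
  thus ?thesis by (simp add: d)
qed

text \<open>
  Here the middle vertex in the first coordinate is the lowest in the second, and the doubled area is
  \<open>p * (r + s) + r * (p + q) - p * r\<close>. Since \<open>p * r\<close> is at most both \<open>p * (r + s)\<close> and \<open>r * (p + q)\<close>,
  concavity bounds its power by the same expression in the powers; what remains is the product of
  two subadditivity defects.
\<close>

lemma area_powr_le_peak:
  fixes p q r s e :: real
  assumes nn: "0 \<le> p" "0 \<le> q" "0 \<le> r" "0 \<le> s" and e: "0 < e" "e \<le> 1"
  shows "2 * (p * (r + s) + q * r) powr e
    \<le> cross_terms (p powr e) ((p + q) powr e) (q powr e) (r powr e) (s powr e) ((r + s) powr e)"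
proof -
  define P Q T R S W where d: "P = p powr e" "Q = q powr e" "T = (p + q) powr e"
    "R = r powr e" "S = s powr e" "W = (r + s) powr e"
  have "T \<le> P + Q" "W \<le> R + S" using powr_subadditive[of p q e] powr_subadditive[of r s e] nn e
    by (simp_all add: d)
  hence "0 \<le> (P + Q - T) * (R + S - W)" by simp
  have "(p * r) powr e + (p * (r + s) + r * (p + q) - p * r) powr e
      \<le> (p * (r + s)) powr e + (r * (p + q)) powr e"
    using nn e by (intro powr_spread_le) (simp_all add: algebra_simps)
  moreover have "p * (r + s) + r * (p + q) - p * r = p * (r + s) + q * r" by (simp add: algebra_simps)
  ultimately have "P * R + (p * (r + s) + q * r) powr e \<le> P * W + R * T"
    using nn by (simp add: d powr_mult)
  with \<open>0 \<le> (P + Q - T) * (R + S - W)\<close>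
  have "2 * (p * (r + s) + q * r) powr e \<le> cross_terms P T Q R S W"
    by (simp add: cross_terms_def algebra_simps)
  thus ?thesis by (simp add: d)
qed

definition area_powr_bounded where
  "area_powr_bounded e x1 y1 x2 y2 x3 y3 \<longleftrightarrow>
     2 * \<bar>(x2 - x1) * (y3 - y1) - (x3 - x1) * (y2 - y1)\<bar> powr e
     \<le> cross_terms (\<bar>x1 - x2\<bar> powr e) (\<bar>x1 - x3\<bar> powr e) (\<bar>x2 - x3\<bar> powr e)
         (\<bar>y1 - y2\<bar> powr e) (\<bar>y1 - y3\<bar> powr e) (\<bar>y2 - y3\<bar> powr (e::real))"

text \<open>
  Both sides are invariant under permuting the three points and under reflecting either axis, so only the
  two relative orders of the coordinates treated above are left.
\<close>

lemma area_powr_bounded_symmetries: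
  "area_powr_bounded e x2 y2 x1 y1 x3 y3 \<Longrightarrow> area_powr_bounded e x1 y1 x2 y2 x3 y3"
  "area_powr_bounded e x1 y1 x3 y3 x2 y2 \<Longrightarrow> area_powr_bounded e x1 y1 x2 y2 x3 y3"
  "area_powr_bounded e x1 (- y1) x2 (- y2) x3 (- y3) \<Longrightarrow> area_powr_bounded e x1 y1 x2 y2 x3 y3"
  "area_powr_bounded e (- x1) y1 (- x2) y2 (- x3) y3 \<Longrightarrow> area_powr_bounded e x1 y1 x2 y2 x3 y3"
proof -
  have area: "\<bar>(x1 - x2) * (y3 - y2) - (x3 - x2) * (y1 - y2)\<bar>
      = \<bar>(x2 - x1) * (y3 - y1) - (x3 - x1) * (y2 - y1)\<bar>"
    "\<bar>(x3 - x1) * (y2 - y1) - (x2 - x1) * (y3 - y1)\<bar>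
      = \<bar>(x2 - x1) * (y3 - y1) - (x3 - x1) * (y2 - y1)\<bar>"
    "\<bar>(x2 - x1) * ((-y3) - (-y1)) - (x3 - x1) * ((-y2) - (-y1))\<bar>
      = \<bar>(x2 - x1) * (y3 - y1) - (x3 - x1) * (y2 - y1)\<bar>"
    "\<bar>((-x2) - (-x1)) * (y3 - y1) - ((-x3) - (-x1)) * (y2 - y1)\<bar>
      = \<bar>(x2 - x1) * (y3 - y1) - (x3 - x1) * (y2 - y1)\<bar>"
    by (simp_all add: abs_eq_iff algebra_simps)
  have dist: "\<bar>a - b\<bar> = \<bar>b - a\<bar>" "\<bar>(-a) - (-b)\<bar> = \<bar>a - b\<bar>" for a b :: real by auto
  show "area_powr_bounded e x2 y2 x1 y1 x3 y3 \<Longrightarrow> area_powr_bounded e x1 y1 x2 y2 x3 y3"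
    unfolding area_powr_bounded_def area dist(1)[of x2 x1] dist(1)[of y2 y1]
    by (simp add: cross_terms_def algebra_simps)
  show "area_powr_bounded e x1 y1 x3 y3 x2 y2 \<Longrightarrow> area_powr_bounded e x1 y1 x2 y2 x3 y3"
    unfolding area_powr_bounded_def area dist(1)[of x3 x2] dist(1)[of y3 y2]
    by (simp add: cross_terms_def algebra_simps)
  show "area_powr_bounded e x1 (- y1) x2 (- y2) x3 (- y3) \<Longrightarrow> area_powr_bounded e x1 y1 x2 y2 x3 y3"
    "area_powr_bounded e (- x1) y1 (- x2) y2 (- x3) y3 \<Longrightarrow> area_powr_bounded e x1 y1 x2 y2 x3 y3"
    unfolding area_powr_bounded_def area dist(2) by simp_all
qed

lemma area_powr_bounded_between:
  assumes "x1 \<le> x2" "x2 \<le> x3" "y1 \<le> y2" "y2 \<le> y3" "0 < e" "e \<le> 1"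
  shows "area_powr_bounded e x1 y1 x2 y2 x3 y3"
proof -
  have "(x2 - x1) * (y3 - y1) - (x3 - x1) * (y2 - y1) = (x2 - x1) * (y3 - y2) - (x3 - x2) * (y2 - y1)"
    by (simp add: algebra_simps)
  thus ?thesis
    using area_powr_le_monotone[of "x2 - x1" "x3 - x2" "y2 - y1" "y3 - y2" e] assms
    by (simp add: area_powr_bounded_def)
qed

lemma area_powr_bounded_below:
  assumes "x1 \<le> x2" "x2 \<le> x3" "y2 \<le> y1" "y1 \<le> y3" "0 < e" "e \<le> 1"
  shows "area_powr_bounded e x1 y1 x2 y2 x3 y3"
proof -
  have "0 \<le> (x2 - x1) * (y3 - y1) + (x3 - x1) * (y1 - y2)" using assms by simp
  hence "\<bar>(x2 - x1) * (y3 - y1) - (x3 - x1) * (y2 - y1)\<bar>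
      = (x2 - x1) * ((y1 - y2) + (y3 - y1)) + (x3 - x2) * (y1 - y2)"
    by (simp add: algebra_simps)
  thus ?thesis using area_powr_le_peak[of "x2 - x1" "x3 - x2" "y1 - y2" "y3 - y1" e] assms
    by (simp add: area_powr_bounded_def)
qed

lemma area_powr_bounded_sorted:
  assumes x: "x1 \<le> x2" "x2 \<le> x3" and e: "0 < e" "e \<le> 1"
  shows "area_powr_bounded e x1 y1 x2 y2 x3 y3"
proof -
  have low: "area_powr_bounded e x1 y1 x2 y2 x3 y3" if "y2 \<le> y1" "y2 \<le> y3" for y1 y2 y3
  proof (cases "y1 \<le> y3")
    case True
    then show ?thesis using that x e area_powr_bounded_below by blast
  next
    case False
    have "area_powr_bounded e (- x3) y3 (- x2) y2 (- x1) y1"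
      using False that x e by (intro area_powr_bounded_below) auto
    then show ?thesis by (meson area_powr_bounded_symmetries)
  qed
  consider "y1 \<le> y2" "y2 \<le> y3" | "-y1 \<le> -y2" "-y2 \<le> -y3" | "y2 \<le> y1" "y2 \<le> y3"
    | "-y2 \<le> -y1" "-y2 \<le> -y3" by linarith
  then show ?thesis
  proof cases
    case 1
    then show ?thesis using area_powr_bounded_between x e by blast
  next
    case 2
    then show ?thesis using area_powr_bounded_between[OF x 2 e] area_powr_bounded_symmetries(3) by blast
  next
    case 3
    then show ?thesis using low by blast
  next
    case 4
    then show ?thesis using low[OF 4] area_powr_bounded_symmetries(3) by blast
  qed
qed

lemma area_powr_le:
  assumes e: "0 < e" "e \<le> 1"
  shows "area_powr_bounded e x1 y1 x2 y2 x3 y3"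
proof -
  note S = area_powr_bounded_sorted[OF _ _ e]
  consider "x1 \<le> x2" "x2 \<le> x3" | "x1 \<le> x3" "x3 \<le> x2" | "x2 \<le> x1" "x1 \<le> x3" | "x2 \<le> x3" "x3 \<le> x1"
    | "x3 \<le> x1" "x1 \<le> x2" | "x3 \<le> x2" "x2 \<le> x1" by linarith
  then show ?thesis by cases (meson S area_powr_bounded_symmetries(1,2))+
qed

section \<open>Distance covariance\<close>

text \<open>
  Sort the values of \<open>y\<close> as \<open>x\<^sub>0 < x\<^sub>1 < \<dots>\<close>, and let \<open>L\<close> be the \<open>p\<close>-th power of their spread. Then
  \<open>L - \<bar>x\<^sub>i - x\<^sub>j\<bar> powr p\<close> is the total weight of the index intervals that contain both \<open>i\<close> and \<open>j\<close>, where the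
  weight of an interval is the mixed second difference of this function at its end points. These weights are
  non-negative since \<open>x powr p\<close> is concave and, for the intervals at either end, increasing.
\<close>

lemma concave_distance_kernel:
  fixes y :: "'i \<Rightarrow> real" and p :: real
  assumes fin: "finite I" and p: "0 < p" "p \<le> 1"
  shows "\<exists>L (K :: (nat \<times> nat) set) f. finite K \<and>
    (\<forall>i\<in>I. \<forall>j\<in>I. \<bar>y i - y j\<bar> powr p = L - (\<Sum>m\<in>K. f m i * f m j))"
proof -
  define xs where "xs = sorted_list_of_set (y ` I)"
  define n where "n = length xs"
  have set_xs: "set xs = y ` I" using fin by (simp add: xs_def)
  have mono: "xs ! k \<le> xs ! l" if "k \<le> l" "l < n" for k l
    using that sorted_nth_mono[of xs k l] by (simp add: xs_def n_def)
  have "\<forall>i\<in>I. \<exists>k<n. xs ! k = y i"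
    unfolding n_def using set_xs by (metis imageI in_set_conv_nth)
  then obtain idx where idx: "\<And>i. i \<in> I \<Longrightarrow> idx i < n" "\<And>i. i \<in> I \<Longrightarrow> xs ! idx i = y i" by metis
  define b where "b = (\<lambda>k l. \<bar>xs ! l - xs ! k\<bar> powr p)"
  have b_eq: "b k l = (xs ! l - xs ! k) powr p" if "k \<le> l" "l < n" for k l
    using mono[OF that] by (simp add: b_def)
  define L where "L = b 0 (n - 1)"
  \<comment> \<open>Extended by zero; the first index is shifted so that \<open>0\<close> lies before the first value.\<close>
  define h where "h = (\<lambda>k l. if k = 0 \<or> n \<le> l then 0 else L - b (k - 1) l)"
  define W where "W = (\<lambda>k l. (h (Suc k) l - h k l) - (h (Suc k) (Suc l) - h k (Suc l)))"
  have W_nonneg: "0 \<le> W k l" if kl: "k \<le> l" "l < n" for k l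
  proof (cases "k = 0")
    case True
    show ?thesis
    proof (cases "Suc l < n")
      case True
      have "b 0 l \<le> b 0 (Suc l)"
        unfolding b_eq[OF _ kl(2), of 0, simplified] b_eq[OF _ True, of 0, simplified]
        using True p mono[of 0 l] mono[of l "Suc l"] by (intro powr_mono2) auto
      then show ?thesis using True kl \<open>k = 0\<close> by (simp add: W_def h_def)
    next
      case False
      hence "l = n - 1" using kl by simp
      then show ?thesis using kl \<open>k = 0\<close> by (simp add: W_def h_def L_def)
    qed
  next
    case False
    then obtain j where k: "k = Suc j" by (cases k) auto
    have m: "xs ! j \<le> xs ! k" "xs ! k \<le> xs ! l" using kl k mono by auto
    have bb: "b j l = (xs ! l - xs ! j) powr p" "b k l = (xs ! l - xs ! k) powr p"
      using kl k by (auto intro!: b_eq)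
    show ?thesis
    proof (cases "Suc l < n")
      case True
      have "b k l + b j (Suc l) \<le> b j l + b k (Suc l)"
        using powr_spread_le[of "xs ! l - xs ! k" "xs ! l - xs ! j" "xs ! Suc l - xs ! k" p]
          m mono[of l "Suc l"] True p kl k
        unfolding bb by (simp add: b_eq)
      then show ?thesis using True kl k by (simp add: W_def h_def)
    next
      case False
      have "b k l \<le> b j l" unfolding bb using m p by (intro powr_mono2) auto
      then show ?thesis using False kl k by (simp add: W_def h_def)
    qed
  qed
  have telescope: "(\<Sum>k\<le>i. \<Sum>l=j..<n. W k l) = L - b i j" if "i < n" "j < n" for i j
  proof -
    have "(\<Sum>l=j..<n. W k l) = h (Suc k) j - h k j" for k
    proof -
      have "(\<Sum>l=j..<n. W k l) = - (\<Sum>l=j..<n. (h (Suc k) (Suc l) - h k (Suc l)) - (h (Suc k) l - h k l))"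
        unfolding W_def sum_negf[symmetric] by (intro sum.cong) auto
      also have "\<dots> = - ((h (Suc k) n - h k n) - (h (Suc k) j - h k j))"
        using that by (subst sum_Suc_diff') auto
      finally show ?thesis by (simp add: h_def)
    qed
    hence "(\<Sum>k\<le>i. \<Sum>l=j..<n. W k l) = (\<Sum>k<Suc i. h (Suc k) j - h k j)"
      by (simp add: lessThan_Suc_atMost)
    also have "\<dots> = h (Suc i) j - h 0 j" by (rule sum_lessThan_telescope)
    finally show ?thesis using that by (simp add: h_def)
  qed
  define K where "K = {(k, l). k \<le> l \<and> l < n}"
  define f where "f = (\<lambda>(k, l) i. if k \<le> idx i \<and> idx i \<le> l then sqrt (W k l) else 0)"
  have finK: "finite K" by (rule finite_subset[of _ "{..n} \<times> {..n}"]) (auto simp: K_def)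
  have kernel: "(\<Sum>m\<in>K. f m i * f m j) = L - b (idx i) (idx j)"
    if ij: "i \<in> I" "j \<in> I" and le: "idx i \<le> idx j" for i j
  proof -
    have "(\<Sum>m\<in>K. f m i * f m j) = (\<Sum>(k, l)\<in>{..idx i} \<times> {idx j..<n}. W k l)"
    proof (rule sum.mono_neutral_cong_right[OF finK])
      show "{..idx i} \<times> {idx j..<n} \<subseteq> K" using le by (auto simp: K_def)
      show "\<forall>m\<in>K - {..idx i} \<times> {idx j..<n}. f m i * f m j = 0"
        by (auto simp: K_def f_def split: if_splits)
      show "f m i * f m j = (case m of (k, l) \<Rightarrow> W k l)" if "m \<in> {..idx i} \<times> {idx j..<n}" for m
        using that le W_nonneg by (auto simp: f_def)
    qed
    also have "\<dots> = (\<Sum>k\<le>idx i. \<Sum>l=idx j..<n. W k l)" by (simp add: sum.cartesian_product)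
    finally show ?thesis using telescope idx(1) ij by simp
  qed
  have "\<bar>y i - y j\<bar> powr p = L - (\<Sum>m\<in>K. f m i * f m j)" if ij: "i \<in> I" "j \<in> I" for i j
  proof (cases "idx i \<le> idx j")
    case True
    then show ?thesis using kernel[OF ij True] idx(2) ij by (simp add: b_def abs_minus_commute)
  next
    case False
    hence "(\<Sum>m\<in>K. f m j * f m i) = L - b (idx j) (idx i)" using kernel[OF ij(2,1)] by simp
    then show ?thesis using idx(2) ij by (simp add: b_def mult.commute)
  qed
  with finK show ?thesis by blast
qed

text \<open>
  The (unnormalised) distance covariance of Szekely, Rizzo and Bakirov for the distances \<open>a\<close> and \<open>b\<close> and the
  masses \<open>t\<close>: for total mass one it is \<open>E[a(X,X') b(X,X')] - 2 E[a(X,X') b(X,X'')] + E[a(X,X')] E[b(X,X')]\<close>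
  with independent copies \<open>X, X', X''\<close>.
\<close>

definition dist_cov :: "'i set \<Rightarrow> ('i \<Rightarrow> real) \<Rightarrow> ('i \<Rightarrow> 'i \<Rightarrow> real) \<Rightarrow> ('i \<Rightarrow> 'i \<Rightarrow> real) \<Rightarrow> real" where
  "dist_cov I t a b =
     (\<Sum>i\<in>I. t i)\<^sup>2 * (\<Sum>i\<in>I. \<Sum>j\<in>I. t i * t j * (a i j * b i j))
     - 2 * (\<Sum>i\<in>I. t i) * (\<Sum>i\<in>I. t i * ((\<Sum>j\<in>I. t j * a i j) * (\<Sum>j\<in>I. t j * b i j)))
     + (\<Sum>i\<in>I. \<Sum>j\<in>I. t i * t j * a i j) * (\<Sum>i\<in>I. \<Sum>j\<in>I. t i * t j * b i j)"

lemma dist_cov_commute: "dist_cov I t a b = dist_cov I t b a"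
  by (simp add: dist_cov_def mult.commute)

lemma dist_cov_cong:
  "(\<And>i j. i \<in> I \<Longrightarrow> j \<in> I \<Longrightarrow> a i j = a' i j) \<Longrightarrow> dist_cov I t a b = dist_cov I t a' b"
  by (simp add: dist_cov_def)

lemma dist_cov_diff:
  "dist_cov I t (\<lambda>i j. a i j - a' i j) b = dist_cov I t a b - dist_cov I t a' b"
  by (simp add: dist_cov_def algebra_simps sum.distrib sum_subtractf)

lemma dist_cov_add:
  "dist_cov I t (\<lambda>i j. a i j + a' i j) b = dist_cov I t a b + dist_cov I t a' b"
  by (simp add: dist_cov_def algebra_simps sum.distrib)

lemma dist_cov_sum:
  "dist_cov I t (\<lambda>i j. \<Sum>m\<in>K. a m i j) b = (\<Sum>m\<in>K. dist_cov I t (a m) b)"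
proof (induct K rule: infinite_finite_induct)
  case (insert x F)
  then show ?case by (simp add: dist_cov_add)
qed (simp_all add: dist_cov_def)

text \<open>
  Together with bilinearity this makes distance covariance insensitive to the constant \<open>L\<close> of a kernel
  representation.
\<close>

lemma dist_cov_const: "dist_cov I t (\<lambda>i j. L) b = 0"
proof -
  have "(\<Sum>i\<in>I. \<Sum>j\<in>I. t i * t j * (L * b i j)) = L * (\<Sum>i\<in>I. \<Sum>j\<in>I. t i * t j * b i j)"
    by (simp add: sum_distrib_left ac_simps)
  moreover have "(\<Sum>i\<in>I. t i * ((\<Sum>j\<in>I. t j * L) * (\<Sum>j\<in>I. t j * b i j)))
      = (\<Sum>i\<in>I. t i) * L * (\<Sum>i\<in>I. \<Sum>j\<in>I. t i * t j * b i j)"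
    unfolding sum_distrib_right[symmetric] by (simp add: sum_distrib_left ac_simps)
  moreover have "(\<Sum>i\<in>I. \<Sum>j\<in>I. t i * t j * L) = (\<Sum>i\<in>I. t i)\<^sup>2 * L"
    by (simp add: power2_eq_square sum_product[of t I t I] sum_distrib_right[symmetric])
  ultimately show ?thesis by (simp add: dist_cov_def power2_eq_square)
qed

lemma dist_cov_rank_one:
  "dist_cov I t (\<lambda>i j. f i * f j) (\<lambda>i j. g i * g j)
   = ((\<Sum>i\<in>I. t i) * (\<Sum>i\<in>I. t i * f i * g i) - (\<Sum>i\<in>I. t i * f i) * (\<Sum>i\<in>I. t i * g i))\<^sup>2"
proof -
  have "(\<Sum>i\<in>I. \<Sum>j\<in>I. t i * t j * (f i * f j * (g i * g j))) = (\<Sum>i\<in>I. t i * f i * g i)\<^sup>2"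
    by (simp add: power2_eq_square sum_product ac_simps)
  moreover have rank1: "(\<Sum>i\<in>I. \<Sum>j\<in>I. t i * t j * (f i * f j)) = (\<Sum>i\<in>I. t i * f i)\<^sup>2" for f
    by (simp add: power2_eq_square sum_product ac_simps)
  moreover have "(\<Sum>j\<in>I. t j * (f i * f j)) = f i * (\<Sum>j\<in>I. t j * f j)" for f i
    by (simp add: sum_distrib_left ac_simps)
  hence "(\<Sum>i\<in>I. t i * ((\<Sum>j\<in>I. t j * (f i * f j)) * (\<Sum>j\<in>I. t j * (g i * g j))))
      = (\<Sum>i\<in>I. t i * f i * g i) * ((\<Sum>i\<in>I. t i * f i) * (\<Sum>i\<in>I. t i * g i))"
    by (simp add: sum_distrib_right ac_simps)
  ultimately show ?thesis by (simp add: dist_cov_def power2_eq_square algebra_simps)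
qed

lemma dist_cov_kernel:
  assumes "\<And>i j. i \<in> I \<Longrightarrow> j \<in> I \<Longrightarrow> a i j = L - (\<Sum>m\<in>K. f m i * f m j)"
  shows "dist_cov I t a b = - (\<Sum>m\<in>K. dist_cov I t (\<lambda>i j. f m i * f m j) b)"
  using dist_cov_cong[OF assms, where b = b and t = t and I = I]
  by (simp add: dist_cov_diff dist_cov_const dist_cov_sum)

text \<open>
  Expanding both kernels, the two minus signs cancel and a sum of squares remains.
\<close>

lemma dist_cov_nonneg:
  assumes a: "\<And>i j. i \<in> I \<Longrightarrow> j \<in> I \<Longrightarrow> a i j = L - (\<Sum>m\<in>K. f m i * f m j)"
    and b: "\<And>i j. i \<in> I \<Longrightarrow> j \<in> I \<Longrightarrow> b i j = L' - (\<Sum>m\<in>K'. f' m i * f' m j)"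
  shows "0 \<le> dist_cov I t a b"
proof -
  have "dist_cov I t a b
      = (\<Sum>m\<in>K. \<Sum>m'\<in>K'. dist_cov I t (\<lambda>i j. f' m' i * f' m' j) (\<lambda>i j. f m i * f m j))"
  proof -
    have "dist_cov I t (\<lambda>i j. f m i * f m j) b
        = - (\<Sum>m'\<in>K'. dist_cov I t (\<lambda>i j. f' m' i * f' m' j) (\<lambda>i j. f m i * f m j))" for m
      using dist_cov_kernel[OF b, where b = "\<lambda>i j. f m i * f m j" and t = t]
      by (simp add: dist_cov_commute[of I t _ b])
    thus ?thesis
      using dist_cov_kernel[OF a, where b = b and t = t] by (simp add: sum_negf)
  qed
  also have "0 \<le> \<dots>" by (simp add: dist_cov_rank_one sum_nonneg)
  finally show ?thesis .
qed

lemma dist_cov_powr_nonneg: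
  fixes p :: real
  assumes "finite I" "0 < p" "p \<le> 1"
  shows "0 \<le> dist_cov I t (\<lambda>i j. \<bar>x i - x j\<bar> powr p) (\<lambda>i j. \<bar>y i - y j\<bar> powr p)"
proof -
  obtain L and K :: "(nat \<times> nat) set" and f where
    1: "\<forall>i\<in>I. \<forall>j\<in>I. \<bar>x i - x j\<bar> powr p = L - (\<Sum>m\<in>K. f m i * f m j)"
    using concave_distance_kernel[OF assms] by blast
  obtain L' and K' :: "(nat \<times> nat) set" and f' where
    2: "\<forall>i\<in>I. \<forall>j\<in>I. \<bar>y i - y j\<bar> powr p = L' - (\<Sum>m\<in>K'. f' m i * f' m j)"
    using concave_distance_kernel[OF assms] by blast
  show ?thesis by (rule dist_cov_nonneg[OF 1[rule_format] 2[rule_format]])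
qed

section \<open>The correlation inequality for triangles in the plane\<close>

text \<open>
  Renaming the summation indices brings each of the nine products to one of two standard forms, according to
  whether its two sides share one vertex or coincide.
\<close>

lemma triple_sum_cross_terms:
  fixes a b :: "'i \<Rightarrow> 'i \<Rightarrow> real" and t :: "'i \<Rightarrow> real" and I :: "'i set"
  assumes a: "\<And>i j. a i j = a j i" and b: "\<And>i j. b i j = b j i"
  defines "M \<equiv> \<Sum>i\<in>I. t i * ((\<Sum>j\<in>I. t j * a i j) * (\<Sum>j\<in>I. t j * b i j))"
    and "Q \<equiv> \<Sum>i\<in>I. \<Sum>j\<in>I. t i * t j * (a i j * b i j)"
  shows "(\<Sum>i\<in>I. \<Sum>j\<in>I. \<Sum>k\<in>I. t i * t j * t k *
      cross_terms (a i j) (a i k) (a j k) (b i j) (b i k) (b j k)) = 6 * M - 3 * ((\<Sum>i\<in>I. t i) * Q)"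
proof -
  define T where "T = (\<lambda>F. \<Sum>i\<in>I. \<Sum>j\<in>I. \<Sum>k\<in>I. t i * t j * t k * F i j k)"
  have swap12: "T (\<lambda>i j k. F j i k) = T F" for F
    unfolding T_def by (subst sum.swap) (simp add: ac_simps)
  have swap23: "T (\<lambda>i j k. F i k j) = T F" for F
    unfolding T_def by (rule sum.cong[OF refl], subst sum.swap) (simp add: ac_simps)
  have M2: "T (\<lambda>i j k. a i k * b i j) = M"
    unfolding T_def M_def by (simp add: sum_product sum_distrib_left ac_simps)
  have M1: "T (\<lambda>i j k. a i j * b i k) = M"
    using swap23[of "\<lambda>i j k. a i k * b i j"] M2 by simp
  have M3: "T (\<lambda>i j k. a i j * b j k) = M"
    using swap12[of "\<lambda>i j k. a i j * b i k"] M1 a by simp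
  have M4: "T (\<lambda>i j k. a j k * b i j) = M"
    using swap12[of "\<lambda>i j k. a i k * b i j"] M2 b by simp
  have M5: "T (\<lambda>i j k. a i k * b j k) = M"
    using swap23[of "\<lambda>i j k. a i j * b j k"] M3 b by simp
  have M6: "T (\<lambda>i j k. a j k * b i k) = M"
    using swap12[of "\<lambda>i j k. a i k * b j k"] M5 by simp
  have Q3: "T (\<lambda>i j k. a j k * b j k) = (\<Sum>i\<in>I. t i) * Q"
    unfolding T_def Q_def sum_distrib_right by (simp add: sum_distrib_left ac_simps)
  have Q2: "T (\<lambda>i j k. a i k * b i k) = (\<Sum>i\<in>I. t i) * Q"
    using swap12[of "\<lambda>i j k. a j k * b j k"] Q3 by simp
  have Q1: "T (\<lambda>i j k. a i j * b i j) = (\<Sum>i\<in>I. t i) * Q"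
    using swap23[of "\<lambda>i j k. a i k * b i k"] Q2 by simp
  have add: "T (\<lambda>i j k. F i j k + H i j k) = T F + T H"
    and diff: "T (\<lambda>i j k. F i j k - H i j k) = T F - T H" for F H
    by (simp_all add: T_def algebra_simps sum.distrib sum_subtractf)
  have "T (\<lambda>i j k. cross_terms (a i j) (a i k) (a j k) (b i j) (b i k) (b j k))
      = 6 * M - 3 * ((\<Sum>i\<in>I. t i) * Q)"
    unfolding cross_terms_def add diff M1 M2 M3 M4 M5 M6 Q1 Q2 Q3 by simp
  thus ?thesis by (simp add: T_def)
qed

text \<open>
  Once every area is replaced by its bound, the difference of the two sides is \<open>3 / 2\<close> times the distance
  covariance of the two coordinates.
\<close>

lemma affine_correlation:
  fixes p :: real and x y t :: "'i \<Rightarrow> real"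
  assumes fin: "finite I" and p: "0 < p" "p \<le> 1" and t: "\<And>i. i \<in> I \<Longrightarrow> 0 \<le> t i"
  shows "(\<Sum>i\<in>I. \<Sum>j\<in>I. \<Sum>k\<in>I. t i * t j * t k *
           \<bar>(x j - x i) * (y k - y i) - (x k - x i) * (y j - y i)\<bar> powr p) * (\<Sum>i\<in>I. t i)
    \<le> 3 / 2 * ((\<Sum>i\<in>I. \<Sum>j\<in>I. t i * t j * \<bar>x i - x j\<bar> powr p) *
               (\<Sum>i\<in>I. \<Sum>j\<in>I. t i * t j * \<bar>y i - y j\<bar> powr p))"
    (is "?A * ?G \<le> 3 / 2 * (?B * ?C)")
proof -
  define a where "a = (\<lambda>i j. \<bar>x i - x j\<bar> powr p)"
  define b where "b = (\<lambda>i j. \<bar>y i - y j\<bar> powr p)"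
  define M where "M = (\<Sum>i\<in>I. t i * ((\<Sum>j\<in>I. t j * a i j) * (\<Sum>j\<in>I. t j * b i j)))"
  define Q where "Q = (\<Sum>i\<in>I. \<Sum>j\<in>I. t i * t j * (a i j * b i j))"
  have G: "0 \<le> ?G" using t by (intro sum_nonneg) auto
  have "2 * ?A = (\<Sum>i\<in>I. \<Sum>j\<in>I. \<Sum>k\<in>I. t i * t j * t k *
      (2 * \<bar>(x j - x i) * (y k - y i) - (x k - x i) * (y j - y i)\<bar> powr p))"
    by (simp add: sum_distrib_left ac_simps)
  also have "\<dots> \<le> (\<Sum>i\<in>I. \<Sum>j\<in>I. \<Sum>k\<in>I. t i * t j * t k *
      cross_terms (a i j) (a i k) (a j k) (b i j) (b i k) (b j k))"
    using area_powr_le[OF p] t unfolding area_powr_bounded_def a_def b_def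
    by (intro sum_mono mult_left_mono) auto
  also have "\<dots> = 6 * M - 3 * (?G * Q)"
    unfolding M_def Q_def by (rule triple_sum_cross_terms) (simp_all add: a_def b_def abs_minus_commute)
  finally have "?A \<le> 3 * M - 3 / 2 * (?G * Q)" by simp
  hence "?A * ?G \<le> (3 * M - 3 / 2 * (?G * Q)) * ?G" using G by (rule mult_right_mono)
  moreover have "0 \<le> ?G\<^sup>2 * Q - 2 * ?G * M + ?B * ?C"
    using dist_cov_powr_nonneg[OF fin p, of t x y]
    unfolding dist_cov_def M_def Q_def a_def b_def .
  ultimately show ?thesis by (simp add: algebra_simps power2_eq_square)
qed

lemma tendsto_abs_powr:
  fixes f :: "'a \<Rightarrow> real"
  assumes "(f \<longlongrightarrow> a) F" "0 < p"
  shows "((\<lambda>x. \<bar>f x\<bar> powr p) \<longlongrightarrow> \<bar>a\<bar> powr p) F"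
  using assms by (intro tendsto_powr' tendsto_rabs tendsto_const) auto

definition det3 :: "real \<Rightarrow> real \<Rightarrow> real \<Rightarrow> real \<Rightarrow> real \<Rightarrow> real \<Rightarrow> real \<Rightarrow> real \<Rightarrow> real \<Rightarrow> real" where
  "det3 x1 y1 z1 x2 y2 z2 x3 y3 z3 =
     x1 * (y2 * z3 - y3 * z2) - y1 * (x2 * z3 - x3 * z2) + z1 * (x2 * y3 - x3 * y2)"

text \<open>
  Dividing by the third coordinate turns a vector into the point \<open>(x / z, y / z)\<close> of the plane with mass
  \<open>\<bar>z\<bar> powr p\<close>.
\<close>

lemma homogeneous_correlation_finite:
  fixes p :: real and x y z :: "'i \<Rightarrow> real"
  assumes fin: "finite I" and p: "0 < p" "p \<le> 1" and z: "\<And>i. i \<in> I \<Longrightarrow> z i \<noteq> 0"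
  shows "(\<Sum>i\<in>I. \<Sum>j\<in>I. \<Sum>k\<in>I. \<bar>det3 (x i) (y i) (z i) (x j) (y j) (z j) (x k) (y k) (z k)\<bar> powr p)
      * (\<Sum>i\<in>I. \<bar>z i\<bar> powr p)
    \<le> 3 / 2 * ((\<Sum>i\<in>I. \<Sum>j\<in>I. \<bar>x i * z j - x j * z i\<bar> powr p) *
               (\<Sum>i\<in>I. \<Sum>j\<in>I. \<bar>y i * z j - y j * z i\<bar> powr p))"
proof -
  define t where "t = (\<lambda>i. \<bar>z i\<bar> powr p)"
  define X where "X = (\<lambda>i. x i / z i)"
  define Y where "Y = (\<lambda>i. y i / z i)"
  have xy: "x i = z i * X i" "y i = z i * Y i" if "i \<in> I" for i
    using z[OF that] by (simp_all add: X_def Y_def)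
  have D: "det3 (x i) (y i) (z i) (x j) (y j) (z j) (x k) (y k) (z k)
      = z i * z j * z k * ((X j - X i) * (Y k - Y i) - (X k - X i) * (Y j - Y i))"
    if "i \<in> I" "j \<in> I" "k \<in> I" for i j k
    unfolding det3_def xy[OF that(1)] xy[OF that(2)] xy[OF that(3)] by (simp add: algebra_simps)
  have E: "x i * z j - x j * z i = z i * z j * (X i - X j)"
    "y i * z j - y j * z i = z i * z j * (Y i - Y j)" if "i \<in> I" "j \<in> I" for i j
    unfolding xy[OF that(1)] xy[OF that(2)] by (simp_all add: algebra_simps)
  show ?thesis
    using affine_correlation[OF fin p, of t X Y] by (simp add: D E t_def abs_mult powr_mult cong: sum.cong)
qed

text \<open>
  Vectors with vanishing third coordinate, the points at infinity of the affine picture, are reached as limits.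
\<close>

lemma homogeneous_correlation:
  fixes p :: real and x y z :: "'i \<Rightarrow> real"
  assumes fin: "finite I" and p: "0 < p" "p \<le> 1"
  shows "(\<Sum>i\<in>I. \<Sum>j\<in>I. \<Sum>k\<in>I. \<bar>det3 (x i) (y i) (z i) (x j) (y j) (z j) (x k) (y k) (z k)\<bar> powr p)
      * (\<Sum>i\<in>I. \<bar>z i\<bar> powr p)
    \<le> 3 / 2 * ((\<Sum>i\<in>I. \<Sum>j\<in>I. \<bar>x i * z j - x j * z i\<bar> powr p) *
               (\<Sum>i\<in>I. \<Sum>j\<in>I. \<bar>y i * z j - y j * z i\<bar> powr p))"
    (is "?A z * ?G z \<le> 3 / 2 * (?D x z * ?D y z)")
proof -
  define \<zeta> where "\<zeta> = (\<lambda>\<epsilon> i. if z i = 0 then \<epsilon> else z i)"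
  have lim: "((\<lambda>\<epsilon>. \<zeta> \<epsilon> i) \<longlongrightarrow> z i) (at_right 0)" for i
    by (cases "z i = 0") (simp_all add: \<zeta>_def)
  have "((\<lambda>\<epsilon>. ?A (\<zeta> \<epsilon>) * ?G (\<zeta> \<epsilon>)) \<longlongrightarrow> ?A z * ?G z) (at_right 0)"
    unfolding det3_def using p by (intro tendsto_intros tendsto_abs_powr lim)
  moreover have "((\<lambda>\<epsilon>. 3 / 2 * (?D x (\<zeta> \<epsilon>) * ?D y (\<zeta> \<epsilon>))) \<longlongrightarrow> 3 / 2 * (?D x z * ?D y z)) (at_right 0)"
    using p by (intro tendsto_intros tendsto_abs_powr lim)
  moreover have "?A (\<zeta> \<epsilon>) * ?G (\<zeta> \<epsilon>) \<le> 3 / 2 * (?D x (\<zeta> \<epsilon>) * ?D y (\<zeta> \<epsilon>))" if "0 < \<epsilon>" for \<epsilon>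
    using that by (intro homogeneous_correlation_finite[OF fin p]) (simp add: \<zeta>_def)
  hence "\<forall>\<^sub>F \<epsilon> in at_right 0. ?A (\<zeta> \<epsilon>) * ?G (\<zeta> \<epsilon>) \<le> 3 / 2 * (?D x (\<zeta> \<epsilon>) * ?D y (\<zeta> \<epsilon>))"
    by (auto simp: eventually_at_right_less eventually_at_right_field intro: exI[of _ 1])
  ultimately show ?thesis by (intro tendsto_le[OF trivial_limit_at_right_real])
qed

section \<open>The ratio in terms of lists of vectors\<close>

text \<open>
  The sum of \<open>F\<close> over the sublists with \<open>k\<close> elements, taken by position. It replaces sums over \<open>k\<close>-subsets of an
  index interval: adding a vector at either end is a recursion, and concrete examples are evaluated by rewriting.
\<close>

fun sublist_sum :: "nat \<Rightarrow> 'a list \<Rightarrow> ('a list \<Rightarrow> 'b::comm_monoid_add) \<Rightarrow> 'b" where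
  "sublist_sum 0 xs F = F []"
| "sublist_sum (Suc k) [] F = 0"
| "sublist_sum (Suc k) (x # xs) F = sublist_sum k xs (\<lambda>l. F (x # l)) + sublist_sum (Suc k) xs F"

lemma sublist_sum_snoc:
  "sublist_sum (Suc k) (xs @ [y]) F = sublist_sum (Suc k) xs F + sublist_sum k xs (\<lambda>l. F (l @ [y]))"
proof (induct xs arbitrary: k F)
  case Nil
  then show ?case by (cases k) simp_all
next
  case (Cons x xs)
  then show ?case by (cases k) (simp_all add: ac_simps)
qed

lemma sublist_sum_map: "sublist_sum k (map u xs) F = sublist_sum k xs (\<lambda>l. F (map u l))"
proof (induct xs arbitrary: k F)
  case Nil
  then show ?case by (cases k) simp_all
next
  case (Cons x xs)
  then show ?case by (cases k) simp_all
qed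

lemma sublist_sum_cong:
  "(\<And>l. length l = k \<Longrightarrow> set l \<subseteq> set xs \<Longrightarrow> F l = G l) \<Longrightarrow> sublist_sum k xs F = sublist_sum k xs G"
proof (induct k xs F arbitrary: G rule: sublist_sum.induct)
  case (3 k x xs F)
  have "sublist_sum k xs (\<lambda>l. F (x # l)) = sublist_sum k xs (\<lambda>l. G (x # l))"
    by (rule 3(1)) (auto intro!: 3(3))
  moreover have "sublist_sum (Suc k) xs F = sublist_sum (Suc k) xs G"
    by (rule 3(2)) (auto intro!: 3(3))
  ultimately show ?case by simp
qed auto

lemma sublist_sum_nonneg:
  fixes F :: "'a list \<Rightarrow> real"
  assumes "\<And>l. 0 \<le> F l"
  shows "0 \<le> sublist_sum k xs F"
  using assms by (induct k xs F rule: sublist_sum.induct) simp_all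

lemma sublist_sum_zero: "sublist_sum k xs (\<lambda>l. 0) = 0"
proof (induct xs arbitrary: k)
  case Nil
  then show ?case by (cases k) simp_all
next
  case (Cons x xs)
  then show ?case by (cases k) simp_all
qed

lemma sum_subsets_eq_sublist_sum:
  fixes xs :: "nat list"
  assumes "sorted_wrt (<) xs"
  shows "(\<Sum>M | M \<subseteq> set xs \<and> card M = k. F (sorted_list_of_set M)) = sublist_sum k xs F"
  using assms
proof (induct k xs F rule: sublist_sum.induct)
  case (1 xs F)
  have "{M. M \<subseteq> set xs \<and> card M = 0} = {{}}"
    using finite_subset[OF _ finite_set[of xs]] by auto
  then show ?case by simp
next
  case (2 k F)
  have empty: "{M :: nat set. M \<subseteq> set [] \<and> card M = Suc k} = {}" by auto
  show ?case unfolding empty by simp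
next
  case (3 k x xs F)
  have xs: "sorted_wrt (<) xs" and x: "\<And>y. y \<in> set xs \<Longrightarrow> x < y" using 3(3) by auto
  define S where "S = {M. M \<subseteq> set xs \<and> card M = k}"
  define R where "R = {M. M \<subseteq> set xs \<and> card M = Suc k}"
  have fin: "finite S" "finite R" by (auto simp: S_def R_def)
  have xM: "x \<notin> M" "finite M" if "M \<in> S" for M
    using that x finite_subset[OF _ finite_set[of xs], of M] by (auto simp: S_def)
  have split: "{M. M \<subseteq> set (x # xs) \<and> card M = Suc k} = insert x ` S \<union> R"
  proof (intro equalityI subsetI)
    fix M assume M: "M \<in> {M. M \<subseteq> set (x # xs) \<and> card M = Suc k}"
    show "M \<in> insert x ` S \<union> R"
    proof (cases "x \<in> M")
      case True
      then have "M = insert x (M - {x})" "M - {x} \<in> S"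
        using M by (auto simp: S_def)
      then show ?thesis by blast
    qed (use M in \<open>auto simp: R_def\<close>)
  next
    fix M assume "M \<in> insert x ` S \<union> R"
    then show "M \<in> {M. M \<subseteq> set (x # xs) \<and> card M = Suc k}"
    proof
      assume "M \<in> insert x ` S"
      then obtain M' where M': "M = insert x M'" "M' \<in> S" by blast
      have "card M = Suc k" "M \<subseteq> set (x # xs)"
        using M' xM[OF M'(2)] by (auto simp: S_def)
      then show ?thesis by simp
    qed (auto simp: R_def)
  qed
  have inj: "inj_on (insert x) S" using xM by (intro inj_onI) (metis Diff_insert_absorb)
  have sorted: "sorted_list_of_set (insert x M) = x # sorted_list_of_set M" if "M \<in> S" for M
  proof -
    have "insort x (sorted_list_of_set M) = x # sorted_list_of_set M"
      using that x xM[OF that] by (intro insort_is_Cons) (auto simp: S_def less_imp_le)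
    then show ?thesis using xM[OF that] by simp
  qed
  have "(\<Sum>M\<in>insert x ` S \<union> R. F (sorted_list_of_set M))
      = (\<Sum>M\<in>insert x ` S. F (sorted_list_of_set M)) + (\<Sum>M\<in>R. F (sorted_list_of_set M))"
    using fin x by (intro sum.union_disjoint) (auto simp: R_def)
  also have "(\<Sum>M\<in>insert x ` S. F (sorted_list_of_set M)) = (\<Sum>M\<in>S. F (x # sorted_list_of_set M))"
    using sorted by (simp add: sum.reindex[OF inj])
  finally show ?case
    using 3(1)[OF xs] 3(2)[OF xs] by (simp only: split S_def R_def sublist_sum.simps)
qed

text \<open>
  Projecting a column along \<open>v\<close> subtracts a multiple of the column \<open>v\<close>, which is right multiplication by a
  unipotent upper triangular matrix. So the volume of the projected vectors is the volume of the
  original ones together with the unit vector \<open>v\<close>.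
\<close>

lemma proj_abs_det_eq_abs_det:
  assumes v: "v \<in> unit_sphere n" and ws: "set ws \<subseteq> carrier_vec n" "length ws = n - 1"
  shows "proj_abs_det n v ws = \<bar>det (mat_of_cols n (v # ws))\<bar>"
proof -
  have vc: "v \<in> carrier_vec n" and vv: "v \<bullet> v = 1"
    using v by (auto simp: unit_sphere_def)
  have n: "n \<noteq> 0" using vc vv by (cases n) (auto simp: scalar_prod_def)
  hence len: "length (v # ws) = n" using ws by simp
  define C where "C = mat_of_cols n (v # ws)"
  define T where "T = mat n n (\<lambda>(i, j). if i = j then 1 else if i = 0 then - (v \<bullet> ((v # ws) ! j)) else 0 :: real)"
  have C: "C \<in> carrier_mat n n" and T: "T \<in> carrier_mat n n"
    using len by (auto simp: C_def T_def mat_of_cols_def)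
  have wc: "(v # ws) ! j \<in> carrier_vec n" if "j < n" for j
    using that vc ws len by (cases j) (auto simp: subset_iff)
  have CT: "C * T = mat_of_cols n (v # map (proj_perp v) ws)" (is "_ = ?P")
  proof (rule eq_matI)
    show "dim_row (C * T) = dim_row ?P" "dim_col (C * T) = dim_col ?P"
      using C T len by (auto simp: mat_of_cols_def)
    fix i j assume "i < dim_row ?P" "j < dim_col ?P"
    hence ij: "i < n" "j < n" using len by (auto simp: mat_of_cols_def)
    have "(C * T) $$ (i, j) = (\<Sum>k = 0..<n. C $$ (i, k) * T $$ (k, j))"
      using C T ij by (simp add: scalar_prod_def)
    also have "\<dots> = (\<Sum>k\<in>{0, j}. C $$ (i, k) * T $$ (k, j))"
      using ij n by (intro sum.mono_neutral_right) (auto simp: T_def)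
    also have "\<dots> = ?P $$ (i, j)"
      using ij n len vc wc[OF ij(2)]
      by (cases j) (auto simp: T_def C_def mat_of_cols_index proj_perp_def)
    finally show "(C * T) $$ (i, j) = ?P $$ (i, j)" .
  qed
  have "upper_triangular T" by (auto simp: T_def upper_triangular_def)
  hence "det T = prod_list (diag_mat T)" using T by (rule det_upper_triangular)
  also have "diag_mat T = map (\<lambda>_. 1) [0..<n]" using T by (auto simp: diag_mat_def T_def)
  also have "prod_list \<dots> = 1" by (simp add: map_replicate_const)
  finally have "det ?P = det C" using det_mult[OF C T] CT by simp
  thus ?thesis
    using proj_abs_det_eq[OF v someI_ex[OF orthonormal_basis_perp_exists[OF v]] ws]
      det_proj_coord_mat[OF v someI_ex[OF orthonormal_basis_perp_exists[OF v]] ws]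
    by (simp add: C_def)
qed

definition det_sum_ratio :: "nat \<Rightarrow> real vec \<Rightarrow> real \<Rightarrow> real vec list \<Rightarrow> real" where
  "det_sum_ratio n v p ws =
     sublist_sum n ws (\<lambda>l. \<bar>det (mat_of_cols n l)\<bar> powr p) /
     sublist_sum (n - 1) ws (\<lambda>l. \<bar>det (mat_of_cols n (v # l))\<bar> powr p)"

lemma det_ratio_eq_det_sum_ratio:
  assumes v: "v \<in> unit_sphere n" and u: "\<And>m. m \<in> {a..b} \<Longrightarrow> u m \<in> carrier_vec n"
  shows "det_ratio n u v p a b = det_sum_ratio n v p (map u [a..<Suc b])"
proof -
  have set: "{a..b} = set [a..<Suc b]" by auto
  have proj: "(\<Sum>M | M \<subseteq> {a..b} \<and> card M = n - 1. proj_abs_det n v (map u (sorted_list_of_set M)) powr p)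
      = (\<Sum>M | M \<subseteq> {a..b} \<and> card M = n - 1.
          \<bar>det (mat_of_cols n (v # map u (sorted_list_of_set M)))\<bar> powr p)"
  proof (rule sum.cong[OF refl], elim CollectE conjE)
    fix M assume M: "M \<subseteq> {a..b}" "card M = n - 1"
    hence "finite M" by (auto intro: finite_subset)
    thus "proj_abs_det n v (map u (sorted_list_of_set M)) powr p
        = \<bar>det (mat_of_cols n (v # map u (sorted_list_of_set M)))\<bar> powr p"
      using M u by (subst proj_abs_det_eq_abs_det[OF v]) auto
  qed
  have lists: "(\<Sum>M | M \<subseteq> {a..b} \<and> card M = k. F (map u (sorted_list_of_set M)))
      = sublist_sum k (map u [a..<Suc b]) F" for k and F :: "real vec list \<Rightarrow> real"
    unfolding sublist_sum_map set
    by (rule sum_subsets_eq_sublist_sum[where F = "\<lambda>l. F (map u l)"]) (rule sorted_wrt_upt)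
  show ?thesis
    unfolding det_ratio_def det_sum_ratio_def proj
      lists[where k = n and F = "\<lambda>l. \<bar>det (mat_of_cols n l)\<bar> powr p"]
      lists[where k = "n - 1" and F = "\<lambda>l. \<bar>det (mat_of_cols n (v # l))\<bar> powr p"] ..
qed

lemma det_mat_of_cols_Cons:
  assumes "length xs = n"
  shows "det (mat_of_cols (Suc n) (x # xs)) =
    (\<Sum>i<Suc n. (-1) ^ i * x $ i *
       det (mat_of_cols n (map (\<lambda>y. vec n (\<lambda>r. y $ (if r < i then r else Suc r))) xs)))"
proof -
  define A where "A = mat_of_cols (Suc n) (x # xs)"
  have A: "A \<in> carrier_mat (Suc n) (Suc n)" using assms by (simp add: A_def mat_of_cols_def)
  have "det A = (\<Sum>i<Suc n. A $$ (i, 0) * cofactor A i 0)"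
    by (rule laplace_expansion_column[OF A]) simp
  also have "\<dots> = (\<Sum>i<Suc n. (-1) ^ i * x $ i *
       det (mat_of_cols n (map (\<lambda>y. vec n (\<lambda>r. y $ (if r < i then r else Suc r))) xs)))"
  proof (rule sum.cong[OF refl])
    fix i assume "i \<in> {..<Suc n}"
    hence i: "i < Suc n" by simp
    have "mat_delete A i 0 = mat_of_cols n (map (\<lambda>y. vec n (\<lambda>r. y $ (if r < i then r else Suc r))) xs)"
      by (rule eq_matI) (use assms i in \<open>auto simp: mat_delete_def A_def mat_of_cols_def\<close>)
    then show "A $$ (i, 0) * cofactor A i 0 = (-1) ^ i * x $ i *
       det (mat_of_cols n (map (\<lambda>y. vec n (\<lambda>r. y $ (if r < i then r else Suc r))) xs))"
      using i by (simp add: cofactor_def A_def mat_of_cols_Cons_index_0)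
  qed
  finally show ?thesis by (simp add: A_def)
qed

lemma det_mat_of_cols_1: "det (mat_of_cols 1 [x]) = (x $ 0 :: real)"
proof -
  have "(mat_of_cols 0 [] :: real mat) \<in> carrier_mat 0 0" by (simp add: mat_of_cols_def)
  from det_dim_zero[OF this] show ?thesis
    using det_mat_of_cols_Cons[of "[]" 0 x] by simp
qed

lemma det_mat_of_cols_2: "det (mat_of_cols 2 [x, y]) = (x $ 0 * y $ 1 - x $ 1 * y $ 0 :: real)"
proof -
  have sum: "(\<Sum>i<2. f i) = f 0 + f (1::nat)" for f :: "nat \<Rightarrow> real"
    by (simp add: numeral_2_eq_2)
  have "Suc 1 = 2" by simp
  note det_mat_of_cols_Cons[of "[y]" 1 x, unfolded this sum list.map det_mat_of_cols_1]
  thus ?thesis by simp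
qed

lemma det_mat_of_cols_3:
  "det (mat_of_cols 3 [x, y, z]) =
    (x $ 0 * (y $ 1 * z $ 2 - y $ 2 * z $ 1) - x $ 1 * (y $ 0 * z $ 2 - y $ 2 * z $ 0)
     + x $ 2 * (y $ 0 * z $ 1 - y $ 1 * z $ 0) :: real)"
proof -
  have sum: "(\<Sum>i<3. f i) = f 0 + f 1 + f (2::nat)" for f :: "nat \<Rightarrow> real"
    by (simp add: numeral_3_eq_3 numeral_2_eq_2)
  have "Suc 2 = 3" by simp
  note det_mat_of_cols_Cons[of "[y, z]" 2 x, unfolded this sum list.map det_mat_of_cols_2]
  thus ?thesis by (simp add: numeral_2_eq_2)
qed

lemma det_mat_of_cols_4:
  "det (mat_of_cols 4 [x, y, z, w]) =
     (x $ 0 * det (mat_of_cols 3 (map (\<lambda>u. vec_of_list [u $ 1, u $ 2, u $ 3]) [y, z, w]))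
      - x $ 1 * det (mat_of_cols 3 (map (\<lambda>u. vec_of_list [u $ 0, u $ 2, u $ 3]) [y, z, w]))
      + x $ 2 * det (mat_of_cols 3 (map (\<lambda>u. vec_of_list [u $ 0, u $ 1, u $ 3]) [y, z, w]))
      - x $ 3 * det (mat_of_cols 3 (map (\<lambda>u. vec_of_list [u $ 0, u $ 1, u $ 2]) [y, z, w])) :: real)"
proof -
  have sum: "(\<Sum>i<4. f i) = f 0 + f 1 + f 2 + f (3::nat)" for f :: "nat \<Rightarrow> real"
    by (simp add: eval_nat_numeral)
  have s: "Suc 3 = 4" by simp
  have v: "vec 3 f = vec_of_list [f 0, f 1, f 2]" for f :: "nat \<Rightarrow> real"
    by (rule eq_vecI) (auto simp: less_Suc_eq numeral_3_eq_3 numeral_2_eq_2)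
  note det_mat_of_cols_Cons[of "[y, z, w]" 3 x, unfolded s sum list.map v]
  thus ?thesis unfolding list.map by (simp add: eval_nat_numeral del: vec_of_list_Cons)
qed

section \<open>Monotonicity in dimension three\<close>

lemma sum_list_map_nth: "(\<Sum>x\<leftarrow>xs. f x) = (\<Sum>i<length xs. f (xs ! i))"
  by (simp add: sum_list_sum_nth atLeast0LessThan)

lemma sublist_sum_1: "sublist_sum (Suc 0) xs F = (\<Sum>x\<leftarrow>xs. F [x])"
  by (induct xs) simp_all

lemma sublist_sum_2:
  fixes f :: "'a \<Rightarrow> 'a \<Rightarrow> real"
  assumes sym: "\<And>x y. f x y = f y x" and diag: "\<And>x. f x x = 0"
  shows "2 * sublist_sum 2 xs (\<lambda>l. f (l ! 0) (l ! 1)) = (\<Sum>x\<leftarrow>xs. \<Sum>y\<leftarrow>xs. f x y)"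
proof (induct xs)
  case Nil
  then show ?case by (simp add: numeral_2_eq_2)
next
  case (Cons a xs)
  have "(\<Sum>x\<leftarrow>xs. f x a) = (\<Sum>x\<leftarrow>xs. f a x)" by (simp add: sym)
  then show ?case using Cons
    by (simp add: numeral_2_eq_2 sublist_sum_1 sum_list_addf diag)
qed

text \<open>
  Each unordered triple is counted in six orders, and the triples with a repetition contribute nothing.
\<close>

lemma sublist_sum_3:
  fixes f :: "'a \<Rightarrow> 'a \<Rightarrow> 'a \<Rightarrow> real"
  assumes sym: "\<And>x y z. f x y z = f y x z" "\<And>x y z. f x y z = f x z y" and diag: "\<And>x y. f x x y = 0"
  shows "6 * sublist_sum 3 xs (\<lambda>l. f (l ! 0) (l ! 1) (l ! 2))
    = (\<Sum>x\<leftarrow>xs. \<Sum>y\<leftarrow>xs. \<Sum>z\<leftarrow>xs. f x y z)"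
proof (induct xs)
  case Nil
  then show ?case by (simp add: numeral_3_eq_3)
next
  case (Cons a xs)
  have diag': "f x y y = 0" "f x y x = 0" for x y
    using diag[of y x] diag[of x y] sym by metis+
  have swap: "f x a y = f a x y" "f x y a = f a x y" for x y
    using sym by metis+
  have "sublist_sum 3 (a # xs) (\<lambda>l. f (l ! 0) (l ! 1) (l ! 2))
      = sublist_sum 2 xs (\<lambda>l. f a (l ! 0) (l ! 1)) + sublist_sum 3 xs (\<lambda>l. f (l ! 0) (l ! 1) (l ! 2))"
    by (simp add: numeral_3_eq_3 numeral_2_eq_2)
  moreover have "2 * sublist_sum 2 xs (\<lambda>l. f a (l ! 0) (l ! 1)) = (\<Sum>x\<leftarrow>xs. \<Sum>y\<leftarrow>xs. f a x y)"
    by (rule sublist_sum_2) (simp_all add: sym(2)[of a] diag')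
  moreover have "(\<Sum>x\<leftarrow>xs. sum_list (map (f x a) xs)) = (\<Sum>x\<leftarrow>xs. sum_list (map (f a x) xs))"
  proof -
    have "f x a = f a x" for x using sym(1) by (intro ext)
    thus ?thesis by (simp only:)
  qed
  moreover have "sum_list (map (f a a) xs) = 0"
  proof -
    have "f a a = (\<lambda>_. 0)" using diag by (intro ext)
    thus ?thesis by simp
  qed
  ultimately show ?case using Cons
    by (simp add: sum_list_addf diag' swap)
qed

definition det3v :: "real vec \<Rightarrow> real vec \<Rightarrow> real vec \<Rightarrow> real" where
  "det3v x y z = det3 (x $ 0) (x $ 1) (x $ 2) (y $ 0) (y $ 1) (y $ 2) (z $ 0) (z $ 1) (z $ 2)"

lemma det_eq_det3v: "det (mat_of_cols 3 [x, y, z]) = det3v x y z"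
  by (simp add: det_mat_of_cols_3 det3v_def det3_def algebra_simps)

lemma det3v_swap:
  "\<bar>det3v x y z\<bar> = \<bar>det3v y x z\<bar>" "\<bar>det3v x y z\<bar> = \<bar>det3v x z y\<bar>" "det3v x x y = 0" "det3v x y y = 0"
proof -
  have "det3v x y z = - det3v y x z" "det3v x y z = - det3v x z y"
    by (simp_all add: det3v_def det3_def algebra_simps)
  thus "\<bar>det3v x y z\<bar> = \<bar>det3v y x z\<bar>" "\<bar>det3v x y z\<bar> = \<bar>det3v x z y\<bar>" by simp_all
qed (simp_all add: det3v_def det3_def algebra_simps)

text \<open>
  Multiplicativity of the determinant. Expanding by linearity in the rows first keeps the polynomials small.
\<close>

lemma det3_linear_combination:
  "det3 (a1 * x1 + b1 * x2 + c1 * x3) (a1 * y1 + b1 * y2 + c1 * y3) (a1 * z1 + b1 * z2 + c1 * z3)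
        (a2 * x1 + b2 * x2 + c2 * x3) (a2 * y1 + b2 * y2 + c2 * y3) (a2 * z1 + b2 * z2 + c2 * z3)
        (a3 * x1 + b3 * x2 + c3 * x3) (a3 * y1 + b3 * y2 + c3 * y3) (a3 * z1 + b3 * z2 + c3 * z3)
   = det3 a1 b1 c1 a2 b2 c2 a3 b3 c3 * det3 x1 y1 z1 x2 y2 z2 x3 y3 z3"
    (is "?l = ?c * ?d")
proof -
  have lin: "det3 (a * x1 + b * x2 + c * x3) (a * y1 + b * y2 + c * y3) (a * z1 + b * z2 + c * z3) r s t r' s' t'
      = a * det3 x1 y1 z1 r s t r' s' t' + b * det3 x2 y2 z2 r s t r' s' t' + c * det3 x3 y3 z3 r s t r' s' t'"
    "det3 r s t (a * x1 + b * x2 + c * x3) (a * y1 + b * y2 + c * y3) (a * z1 + b * z2 + c * z3) r' s' t'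
      = a * det3 r s t x1 y1 z1 r' s' t' + b * det3 r s t x2 y2 z2 r' s' t' + c * det3 r s t x3 y3 z3 r' s' t'"
    "det3 r s t r' s' t' (a * x1 + b * x2 + c * x3) (a * y1 + b * y2 + c * y3) (a * z1 + b * z2 + c * z3)
      = a * det3 r s t r' s' t' x1 y1 z1 + b * det3 r s t r' s' t' x2 y2 z2 + c * det3 r s t r' s' t' x3 y3 z3"
    for a b c r s t r' s' t' by (simp_all add: det3_def algebra_simps)
  have alt: "det3 x y z x y z r s t = 0" "det3 x y z r s t x y z = 0" "det3 r s t x y z x y z = 0"
    for x y z r s t by (simp_all add: det3_def algebra_simps)
  have perm: "det3 x1 y1 z1 x3 y3 z3 x2 y2 z2 = - ?d" "det3 x2 y2 z2 x1 y1 z1 x3 y3 z3 = - ?d"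
    "det3 x3 y3 z3 x2 y2 z2 x1 y1 z1 = - ?d" "det3 x2 y2 z2 x3 y3 z3 x1 y1 z1 = ?d"
    "det3 x3 y3 z3 x1 y1 z1 x2 y2 z2 = ?d"
    by (simp_all add: det3_def algebra_simps)
  have c: "?c = a1 * (b2 * c3 - b3 * c2) - b1 * (a2 * c3 - a3 * c2) + c1 * (a2 * b3 - a3 * b2)"
    by (simp add: det3_def)
  show ?thesis unfolding lin alt perm c by (simp add: algebra_simps)
qed

text \<open>
  Cramer's rule.
\<close>

lemma vec3_coordinates:
  assumes "det3v v w e \<noteq> 0"
  obtains a b c where "\<And>k. k < 3 \<Longrightarrow> u $ k = a * v $ k + b * w $ k + c * e $ k"
proof -
  define d where "d = det3v v w e"
  have "d * u $ k = det3v u w e * v $ k + det3v v u e * w $ k + det3v v w u * e $ k"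
    if "k \<in> {0, 1, 2}" for k
    using that unfolding d_def det3v_def det3_def by (auto simp: algebra_simps)
  hence "u $ k = det3v u w e / d * v $ k + det3v v u e / d * w $ k + det3v v w u / d * e $ k"
    if "k \<in> {0, 1, 2}" for k
    using that assms by (simp add: d_def field_simps)
  moreover have "k \<in> {0, 1, 2}" if "k < 3" for k :: nat using that by auto
  ultimately show ?thesis
    by (intro that[of "det3v u w e / d" "det3v v u e / d" "det3v v w u / d"]) blast
qed

text \<open>
  In the basis \<open>v, w, e\<close> the determinants with \<open>v\<close>, with \<open>w\<close> and with both lose the corresponding
  coordinates; every determinant carries the same factor \<open>det3v v w e\<close>, which cancels as both sides are of degree two
  in it.
\<close>

lemma det3v_correlation:
  fixes p :: real and u :: "'i \<Rightarrow> real vec"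
  assumes fin: "finite I" and p: "0 < p" "p \<le> 1"
  shows "(\<Sum>i\<in>I. \<Sum>j\<in>I. \<Sum>k\<in>I. \<bar>det3v (u i) (u j) (u k)\<bar> powr p) * (\<Sum>i\<in>I. \<bar>det3v v w (u i)\<bar> powr p)
    \<le> 3 / 2 * ((\<Sum>i\<in>I. \<Sum>j\<in>I. \<bar>det3v w (u i) (u j)\<bar> powr p) *
               (\<Sum>i\<in>I. \<Sum>j\<in>I. \<bar>det3v v (u i) (u j)\<bar> powr p))"
    (is "?A * ?G \<le> 3 / 2 * (?E * ?D)")
proof (cases "\<exists>i\<in>I. det3v v w (u i) \<noteq> 0")
  case False
  hence "?G = 0" by simp
  moreover have "0 \<le> ?E * ?D" by (intro mult_nonneg_nonneg sum_nonneg) auto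
  ultimately show ?thesis by (metis mult_zero_right mult_nonneg_nonneg zero_le_divide_iff zero_le_numeral)
next
  case True
  then obtain e where e: "det3v v w e \<noteq> 0" by blast
  define d where "d = \<bar>det3v v w e\<bar> powr p"
  have d: "d > 0" using e by (simp add: d_def)
  have "\<forall>i. \<exists>a b c. \<forall>k<3. u i $ k = a * v $ k + b * w $ k + c * e $ k"
    using vec3_coordinates[OF e] by metis
  then obtain a b c where u: "\<And>i k. k < 3 \<Longrightarrow> u i $ k = a i * v $ k + b i * w $ k + c i * e $ k"
    by metis
  have coord: "u i $ 0 = a i * v $ 0 + b i * w $ 0 + c i * e $ 0"
    "u i $ 1 = a i * v $ 1 + b i * w $ 1 + c i * e $ 1"
    "u i $ 2 = a i * v $ 2 + b i * w $ 2 + c i * e $ 2" for i by (rule u; simp)+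
  have A: "det3v (u i) (u j) (u k)
      = det3 (a i) (b i) (c i) (a j) (b j) (c j) (a k) (b k) (c k) * det3v v w e" for i j k
    unfolding det3v_def coord by (rule det3_linear_combination)
  have G: "det3v v w (u i) = c i * det3v v w e" for i
    unfolding det3v_def coord det3_def by (simp add: algebra_simps)
  have D: "det3v v (u i) (u j) = (b i * c j - b j * c i) * det3v v w e" for i j
    unfolding det3v_def coord det3_def by (simp add: algebra_simps)
  have E: "det3v w (u i) (u j) = - (a i * c j - a j * c i) * det3v v w e" for i j
    unfolding det3v_def coord det3_def by (simp add: algebra_simps)
  have "(\<Sum>i\<in>I. \<Sum>j\<in>I. \<Sum>k\<in>I. \<bar>det3 (a i) (b i) (c i) (a j) (b j) (c j) (a k) (b k) (c k)\<bar> powr p)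
      * (\<Sum>i\<in>I. \<bar>c i\<bar> powr p)
    \<le> 3 / 2 * ((\<Sum>i\<in>I. \<Sum>j\<in>I. \<bar>a i * c j - a j * c i\<bar> powr p) *
               (\<Sum>i\<in>I. \<Sum>j\<in>I. \<bar>b i * c j - b j * c i\<bar> powr p))" (is "?l \<le> ?r")
    by (rule homogeneous_correlation[OF fin p])
  hence bound: "?l * (d * d) \<le> ?r * (d * d)" using d by (intro mult_right_mono) auto
  have sums: "(\<Sum>i\<in>I. \<Sum>j\<in>I. \<Sum>k\<in>I. F i j k * d) = (\<Sum>i\<in>I. \<Sum>j\<in>I. \<Sum>k\<in>I. F i j k) * d"
    "(\<Sum>i\<in>I. \<Sum>j\<in>I. H i j * d) = (\<Sum>i\<in>I. \<Sum>j\<in>I. H i j) * d"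
    "(\<Sum>i\<in>I. h i * d) = (\<Sum>i\<in>I. h i) * d" for F H h
    by (simp_all add: sum_distrib_right)
  show ?thesis
    unfolding A G D E abs_mult powr_mult abs_minus_cancel d_def[symmetric] sums
    using bound by (simp only: ac_simps)
qed

lemma sublist_sum_2_det3v:
  "2 * sublist_sum 2 ws (\<lambda>l. \<bar>det3v x (l ! 0) (l ! 1)\<bar> powr p)
   = (\<Sum>i<length ws. \<Sum>j<length ws. \<bar>det3v x (ws ! i) (ws ! j)\<bar> powr p)"
proof -
  have "\<bar>det3v x y z\<bar> powr p = \<bar>det3v x z y\<bar> powr p" "\<bar>det3v x y y\<bar> powr p = 0" for y z
    using det3v_swap(2)[of x y z] det3v_swap(4) by simp_all
  from sublist_sum_2[of "\<lambda>y z. \<bar>det3v x y z\<bar> powr p" ws, OF this, unfolded sum_list_map_nth]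
  show ?thesis .
qed

lemma sublist_sum_3_det3v:
  "6 * sublist_sum 3 ws (\<lambda>l. \<bar>det3v (l ! 0) (l ! 1) (l ! 2)\<bar> powr p)
   = (\<Sum>i<length ws. \<Sum>j<length ws. \<Sum>k<length ws. \<bar>det3v (ws ! i) (ws ! j) (ws ! k)\<bar> powr p)"
proof -
  have "\<bar>det3v x y z\<bar> powr p = \<bar>det3v y x z\<bar> powr p" "\<bar>det3v x y z\<bar> powr p = \<bar>det3v x z y\<bar> powr p"
    "\<bar>det3v x x z\<bar> powr p = 0" for x y z
    using det3v_swap(1,2)[of x y z] det3v_swap(3) by simp_all
  from sublist_sum_3[of "\<lambda>x y z. \<bar>det3v x y z\<bar> powr p" ws, OF this, unfolded sum_list_map_nth]
  show ?thesis .
qed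

lemma sublist_sum_det_3:
  "sublist_sum 3 ws (\<lambda>l. \<bar>det (mat_of_cols 3 l)\<bar> powr p)
     = sublist_sum 3 ws (\<lambda>l. \<bar>det3v (l ! 0) (l ! 1) (l ! 2)\<bar> powr p)"
proof (rule sublist_sum_cong)
  fix l :: "real vec list" assume "length l = 3"
  then obtain x y z where "l = [x, y, z]" by (auto simp: numeral_3_eq_3 length_Suc_conv)
  then show "\<bar>det (mat_of_cols 3 l)\<bar> powr p = \<bar>det3v (l ! 0) (l ! 1) (l ! 2)\<bar> powr p"
    by (simp add: det_eq_det3v)
qed

lemma sublist_sum_det_2:
  "sublist_sum 2 ws (\<lambda>l. \<bar>det (mat_of_cols 3 (v # l))\<bar> powr p)
     = sublist_sum 2 ws (\<lambda>l. \<bar>det3v v (l ! 0) (l ! 1)\<bar> powr p)"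
proof (rule sublist_sum_cong)
  fix l :: "real vec list" assume "length l = 2"
  then obtain x y where "l = [x, y]" by (auto simp: numeral_2_eq_2 length_Suc_conv)
  then show "\<bar>det (mat_of_cols 3 (v # l))\<bar> powr p = \<bar>det3v v (l ! 0) (l ! 1)\<bar> powr p"
    by (simp add: det_eq_det3v)
qed

lemma det_sum_ratio_nonneg: "0 \<le> det_sum_ratio n v p ws"
  unfolding det_sum_ratio_def by (intro divide_nonneg_nonneg sublist_sum_nonneg) auto

text \<open>
  With \<open>A\<close>, \<open>D\<close> the old numerator and denominator, the new ratio is \<open>(A + E) / (D + G)\<close>, and it is at least
  \<open>A / D\<close> because \<open>A * G \<le> D * E\<close>. Passing from unordered to ordered index tuples multiplies \<open>A\<close> by \<open>6\<close> and \<open>D\<close>, \<open>E\<close> by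
  \<open>2\<close> each, which absorbs the constant \<open>3 / 2\<close>.
\<close>

lemma det_sum_ratio_3_snoc:
  assumes p: "0 < p" "p \<le> 1"
  shows "det_sum_ratio 3 v p ws \<le> det_sum_ratio 3 v p (ws @ [w])"
proof -
  define A where "A = sublist_sum 3 ws (\<lambda>l. \<bar>det3v (l ! 0) (l ! 1) (l ! 2)\<bar> powr p)"
  define D where "D = sublist_sum 2 ws (\<lambda>l. \<bar>det3v v (l ! 0) (l ! 1)\<bar> powr p)"
  define E where "E = sublist_sum 2 ws (\<lambda>l. \<bar>det3v w (l ! 0) (l ! 1)\<bar> powr p)"
  define G where "G = (\<Sum>i<length ws. \<bar>det3v v w (ws ! i)\<bar> powr p)"
  have "6 * A * G \<le> 3 / 2 * ((2 * E) * (2 * D))"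
    unfolding A_def D_def E_def G_def sublist_sum_2_det3v sublist_sum_3_det3v
    by (rule det3v_correlation[OF _ p]) simp
  hence key: "A * G \<le> D * E" by simp
  have nn: "0 \<le> A" "0 \<le> D" "0 \<le> E" "0 \<le> G"
    unfolding A_def D_def E_def G_def by (auto intro: sublist_sum_nonneg sum_nonneg)
  have old: "det_sum_ratio 3 v p ws = A / D"
    unfolding det_sum_ratio_def A_def D_def by (simp add: sublist_sum_det_3 sublist_sum_det_2)
  have last: "sublist_sum 2 ws (\<lambda>l. \<bar>det3v ((l @ [w]) ! 0) ((l @ [w]) ! 1) ((l @ [w]) ! 2)\<bar> powr p) = E"
    unfolding E_def
  proof (rule sublist_sum_cong)
    fix l :: "real vec list" assume "length l = 2"
    then obtain a b where "l = [a, b]" by (auto simp: numeral_2_eq_2 length_Suc_conv)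
    then show "\<bar>det3v ((l @ [w]) ! 0) ((l @ [w]) ! 1) ((l @ [w]) ! 2)\<bar> powr p
        = \<bar>det3v w (l ! 0) (l ! 1)\<bar> powr p"
      by (simp add: det3v_swap(2)[of a b w] det3v_swap(1)[of a w b])
  qed
  have "sublist_sum 3 (ws @ [w]) (\<lambda>l. \<bar>det3v (l ! 0) (l ! 1) (l ! 2)\<bar> powr p) = A + E"
    using sublist_sum_snoc[of 2 ws w "\<lambda>l. \<bar>det3v (l ! 0) (l ! 1) (l ! 2)\<bar> powr p"] last
    by (simp add: A_def)
  moreover have "sublist_sum 2 (ws @ [w]) (\<lambda>l. \<bar>det3v v (l ! 0) (l ! 1)\<bar> powr p) = D + G"
  proof -
    have "sublist_sum 1 ws (\<lambda>l. \<bar>det3v v ((l @ [w]) ! 0) ((l @ [w]) ! 1)\<bar> powr p) = G"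
      by (simp add: sublist_sum_1 G_def sum_list_map_nth det3v_swap(2)[of v _ w])
    moreover have "Suc 1 = 2" by simp
    ultimately show ?thesis
      unfolding D_def using sublist_sum_snoc[of 1 ws w "\<lambda>l. \<bar>det3v v (l ! 0) (l ! 1)\<bar> powr p"]
      by (simp only:)
  qed
  ultimately have new: "det_sum_ratio 3 v p (ws @ [w]) = (A + E) / (D + G)"
    unfolding det_sum_ratio_def by (simp add: sublist_sum_det_3 sublist_sum_det_2)
  show ?thesis
  proof (cases "D = 0")
    case True
    \<comment> \<open>The old ratio is then zero by convention.\<close>
    then show ?thesis using old det_sum_ratio_nonneg by simp
  next
    case False
    hence "0 < D" "0 < D + G" using nn by auto
    then show ?thesis unfolding old new using key
      by (simp add: divide_le_eq le_divide_eq frac_le_eq algebra_simps divide_le_0_iff)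
  qed
qed

lemma det_ratio_3_mono:
  assumes p: "0 < p" "p \<le> 1" and N: "1 \<le> N'" "N' \<le> N"
    and u: "\<forall>m\<in>{1..N}. u m \<in> carrier_vec 3" and v: "v \<in> unit_sphere 3"
  shows "det_ratio 3 u v p 1 N' \<le> det_ratio 3 u v p 1 N"
proof -
  have "det_sum_ratio 3 v p (map u [1..<Suc N']) \<le> det_sum_ratio 3 v p (map u [1..<Suc N])"
    using N(2)
  proof (induct rule: dec_induct)
    case (step k)
    have snoc: "map u [1..<Suc (Suc k)] = map u [1..<Suc k] @ [u (Suc k)]" by simp
    show ?case unfolding snoc
      using step(3) det_sum_ratio_3_snoc[OF p, of v "map u [1..<Suc k]" "u (Suc k)"] by linarith
  qed simp
  moreover have "det_ratio 3 u v p 1 k = det_sum_ratio 3 v p (map u [1..<Suc k])" if "k \<le> N" for k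
    using u that by (intro det_ratio_eq_det_sum_ratio[OF v]) auto
  ultimately show ?thesis using N by simp
qed

section \<open>Raising the dimension of a counterexample\<close>

lemma det_unit_vec_Cons:
  assumes ws: "set ws \<subseteq> carrier_vec n" "length ws = n"
  shows "det (mat_of_cols (Suc n) (unit_vec (Suc n) 0 # map (vCons 0) ws)) = (det (mat_of_cols n ws) :: real)"
proof -
  let ?M = "mat_of_cols (Suc n) (unit_vec (Suc n) 0 # map (vCons 0) ws) :: real mat"
  have "?M = four_block_mat (1\<^sub>m 1) (0\<^sub>m 1 n) (0\<^sub>m n 1) (mat_of_cols n ws)" (is "_ = ?B")
  proof (rule eq_matI)
    fix i j assume "i < dim_row ?B" "j < dim_col ?B"
    hence ij: "i < Suc n" "j < Suc n" using ws by (auto simp: mat_of_cols_def)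
    then show "?M $$ (i, j) = ?B $$ (i, j)"
      using ws by (cases i; cases j) (auto simp: mat_of_cols_def)
  qed (use ws in \<open>auto simp: mat_of_cols_def\<close>)
  then show ?thesis
    using det_four_block_mat_upper_right_zero[of "1\<^sub>m 1" 1 "0\<^sub>m 1 n" n "0\<^sub>m n 1" "mat_of_cols n ws"] ws
    by (simp add: mat_of_cols_def)
qed

lemma det_swap_first_cols:
  assumes "length ws = n"
  shows "det (mat_of_cols (Suc (Suc n)) (a # b # ws)) = - (det (mat_of_cols (Suc (Suc n)) (b # a # ws)) :: real)"
proof -
  let ?A = "mat_of_cols (Suc (Suc n)) (a # b # ws) :: real mat"
  have A: "?A \<in> carrier_mat (Suc (Suc n)) (Suc (Suc n))" using assms by (simp add: mat_of_cols_def)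
  have "swapcols 0 1 ?A = mat_of_cols (Suc (Suc n)) (b # a # ws)"
    by (rule eq_matI) (use assms in \<open>auto simp: mat_of_cols_def nth_Cons split: nat.splits\<close>)
  then show ?thesis using det_swapcols[of 0 "Suc (Suc n)" 1 ?A] A by simp
qed

lemma det_first_row_zero:
  assumes ws: "length ws = Suc n"
  shows "det (mat_of_cols (Suc n) (map (vCons 0) ws)) = (0 :: real)"
proof -
  let ?M = "mat_of_cols (Suc n) (map (vCons 0) ws) :: real mat"
  have M: "?M \<in> carrier_mat (Suc n) (Suc n)" using ws by (simp add: mat_of_cols_def)
  have "det ?M = (\<Sum>j<Suc n. ?M $$ (0, j) * cofactor ?M 0 j)"
    by (rule laplace_expansion_row[OF M]) simp
  also have "\<dots> = 0" using ws by (intro sum.neutral) (auto simp: mat_of_cols_def)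
  finally show ?thesis .
qed

text \<open>
  Put the new basis vector in front of vectors embedded into its orthogonal complement. A determinant
  without it has a zero row, and one containing it reduces to the determinant in the smaller space.
\<close>

lemma det_sum_ratio_lift:
  assumes ws: "set ws \<subseteq> carrier_vec n" and v: "v \<in> carrier_vec n" and n: "n \<ge> 1"
  shows "det_sum_ratio (Suc n) (vCons 0 v) p (unit_vec (Suc n) 0 # map (vCons 0) ws) = det_sum_ratio n v p ws"
proof -
  let ?e = "unit_vec (Suc n) 0 :: real vec"
  have "sublist_sum (Suc n) (?e # map (vCons 0) ws) (\<lambda>l. \<bar>det (mat_of_cols (Suc n) l)\<bar> powr p)
      = sublist_sum n ws (\<lambda>l. \<bar>det (mat_of_cols (Suc n) (?e # map (vCons 0) l))\<bar> powr p)
      + sublist_sum (Suc n) ws (\<lambda>l. \<bar>det (mat_of_cols (Suc n) (map (vCons 0) l))\<bar> powr p)"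
    by (simp add: sublist_sum_map)
  also have "sublist_sum (Suc n) ws (\<lambda>l. \<bar>det (mat_of_cols (Suc n) (map (vCons 0) l))\<bar> powr p)
      = sublist_sum (Suc n) ws (\<lambda>l. 0)"
    by (rule sublist_sum_cong) (simp add: det_first_row_zero)
  also have "sublist_sum n ws (\<lambda>l. \<bar>det (mat_of_cols (Suc n) (?e # map (vCons 0) l))\<bar> powr p)
      = sublist_sum n ws (\<lambda>l. \<bar>det (mat_of_cols n l)\<bar> powr p)"
    using ws by (intro sublist_sum_cong) (subst det_unit_vec_Cons; auto)
  finally have num: "sublist_sum (Suc n) (?e # map (vCons 0) ws) (\<lambda>l. \<bar>det (mat_of_cols (Suc n) l)\<bar> powr p)
      = sublist_sum n ws (\<lambda>l. \<bar>det (mat_of_cols n l)\<bar> powr p)"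
    by (simp add: sublist_sum_zero)
  obtain k where k: "n = Suc k" using n by (cases n) auto
  have "sublist_sum n (?e # map (vCons 0) ws) (\<lambda>l. \<bar>det (mat_of_cols (Suc n) (vCons 0 v # l))\<bar> powr p)
      = sublist_sum k ws (\<lambda>l. \<bar>det (mat_of_cols (Suc n) (vCons 0 v # ?e # map (vCons 0) l))\<bar> powr p)
      + sublist_sum n ws (\<lambda>l. \<bar>det (mat_of_cols (Suc n) (map (vCons 0) (v # l)))\<bar> powr p)"
    by (simp add: sublist_sum_map k)
  also have "sublist_sum n ws (\<lambda>l. \<bar>det (mat_of_cols (Suc n) (map (vCons 0) (v # l)))\<bar> powr p)
      = sublist_sum n ws (\<lambda>l. 0)"
    by (rule sublist_sum_cong) (subst det_first_row_zero; simp)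
  also have "sublist_sum k ws (\<lambda>l. \<bar>det (mat_of_cols (Suc n) (vCons 0 v # ?e # map (vCons 0) l))\<bar> powr p)
      = sublist_sum k ws (\<lambda>l. \<bar>det (mat_of_cols n (v # l))\<bar> powr p)"
  proof (rule sublist_sum_cong)
    fix l :: "real vec list" assume l: "length l = k" "set l \<subseteq> set ws"
    have "\<bar>det (mat_of_cols (Suc n) (vCons 0 v # ?e # map (vCons 0) l))\<bar>
        = \<bar>det (mat_of_cols (Suc n) (?e # map (vCons 0) (v # l)))\<bar>"
      using det_swap_first_cols[of "map (vCons 0) l" k "vCons 0 v" ?e] l k by simp
    also have "\<dots> = \<bar>det (mat_of_cols n (v # l))\<bar>"
      using l ws v k by (subst det_unit_vec_Cons) auto
    finally show "\<bar>det (mat_of_cols (Suc n) (vCons 0 v # ?e # map (vCons 0) l))\<bar> powr p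
      = \<bar>det (mat_of_cols n (v # l))\<bar> powr p" by simp
  qed
  finally have den: "sublist_sum n (?e # map (vCons 0) ws) (\<lambda>l. \<bar>det (mat_of_cols (Suc n) (vCons 0 v # l))\<bar> powr p)
      = sublist_sum (n - 1) ws (\<lambda>l. \<bar>det (mat_of_cols n (v # l))\<bar> powr p)"
    by (simp add: sublist_sum_zero k)
  show ?thesis unfolding det_sum_ratio_def num using den by simp
qed

text \<open>
  The new vectors \<open>ws\<close> come last and \<open>us\<close> is the initial segment, so that the vector added by
  \<open>det_sum_ratio_lift\<close> can join \<open>us\<close> without disturbing the comparison.
\<close>

definition ratio_drops :: "nat \<Rightarrow> real \<Rightarrow> real vec \<Rightarrow> real vec list \<Rightarrow> real vec list \<Rightarrow> bool" where
  "ratio_drops n p v us ws \<longleftrightarrow> v \<in> unit_sphere n \<and> set (us @ ws) \<subseteq> carrier_vec n \<and> us \<noteq> [] \<and>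
     det_sum_ratio n v p (us @ ws) < det_sum_ratio n v p us"

lemma ratio_drops_Suc:
  assumes "ratio_drops n p v us ws" "n \<ge> 1"
  shows "ratio_drops (Suc n) p (vCons 0 v) (unit_vec (Suc n) 0 # map (vCons 0) us) (map (vCons 0) ws)"
proof -
  have v: "v \<in> carrier_vec n" and c: "set (us @ ws) \<subseteq> carrier_vec n" "set us \<subseteq> carrier_vec n"
    using assms by (auto simp: ratio_drops_def unit_sphere_def)
  have "det_sum_ratio (Suc n) (vCons 0 v) p ((unit_vec (Suc n) 0 # map (vCons 0) us) @ map (vCons 0) ws)
      = det_sum_ratio n v p (us @ ws)"
    using det_sum_ratio_lift[OF c(1) v assms(2)] by simp
  then show ?thesis
    using assms det_sum_ratio_lift[OF c(2) v assms(2), of p]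
    by (auto simp: ratio_drops_def unit_sphere_def)
qed

lemma ratio_drops_all_dims:
  assumes "ratio_drops k p v us ws" "1 \<le> k" "k \<le> n"
  shows "\<exists>v us ws. ratio_drops n p v us ws"
  using assms(3)
proof (induct rule: dec_induct)
  case base
  then show ?case using assms(1) by blast
next
  case (step m)
  then show ?case using ratio_drops_Suc assms(2) by (meson order_trans)
qed

lemma ratio_drops_det_ratio:
  assumes "ratio_drops n p v us ws"
  shows "\<exists>N' N (u :: nat \<Rightarrow> real vec) v.
    1 \<le> N' \<and> N' \<le> N \<and> (\<forall>m\<in>{1..N}. u m \<in> carrier_vec n) \<and> v \<in> unit_sphere n \<and>
    \<not> det_ratio n u v p 1 N \<ge> det_ratio n u v p 1 N'"
proof -
  define u where "u = (\<lambda>m. (us @ ws) ! (m - 1))"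
  have v: "v \<in> unit_sphere n" and c: "set (us @ ws) \<subseteq> carrier_vec n"
    using assms by (auto simp: ratio_drops_def)
  have uc: "u m \<in> carrier_vec n" if "m \<in> {1..length (us @ ws)}" for m
    using that c nth_mem[of "m - 1" "us @ ws"] unfolding u_def by (auto simp del: set_append nth_mem)
  have take: "map u [1..<Suc k] = take k (us @ ws)" if "k \<le> length (us @ ws)" for k
    by (rule nth_equalityI) (use that in \<open>auto simp: u_def simp del: upt_Suc take_append\<close>)
  have R: "det_ratio n u v p 1 k = det_sum_ratio n v p (take k (us @ ws))" if "k \<le> length (us @ ws)" for k
    using that uc take by (subst det_ratio_eq_det_sum_ratio[OF v]) auto
  have "\<not> det_ratio n u v p 1 (length (us @ ws)) \<ge> det_ratio n u v p 1 (length us)"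
    using R[of "length us"] R[of "length (us @ ws)"] assms by (simp add: ratio_drops_def)
  moreover have "1 \<le> length us" using assms by (cases us) (auto simp: ratio_drops_def)
  ultimately show ?thesis using uc v by (intro exI[of _ "length us"] exI[of _ "length (us @ ws)"] exI[of _ u] exI[of _ v]) auto
qed

section \<open>Counterexamples in dimensions three and four\<close>

lemma ratio_drops_snocI:
  fixes v w :: "real vec"
  assumes carrier: "v \<in> unit_sphere n" "set us \<subseteq> carrier_vec n" "w \<in> carrier_vec n" and n: "n = Suc m" "m = Suc k"
    and "us \<noteq> []"
    and A: "sublist_sum n us (\<lambda>l. \<bar>det (mat_of_cols n l)\<bar> powr p) = A"
    and D: "sublist_sum m us (\<lambda>l. \<bar>det (mat_of_cols n (v # l))\<bar> powr p) = D"
    and E: "sublist_sum m us (\<lambda>l. \<bar>det (mat_of_cols n (l @ [w]))\<bar> powr p) = E"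
    and G: "sublist_sum k us (\<lambda>l. \<bar>det (mat_of_cols n (v # l @ [w]))\<bar> powr p) = G"
    and "0 < D" "0 \<le> G" and less: "D * E < A * G"
  shows "ratio_drops n p v us [w]"
proof -
  have "det_sum_ratio n v p us = A / D"
    using A D n by (simp add: det_sum_ratio_def)
  moreover have "det_sum_ratio n v p (us @ [w]) = (A + E) / (D + G)"
    using A D E G n by (simp add: det_sum_ratio_def sublist_sum_snoc)
  moreover have "(A + E) / (D + G) < A / D"
    using \<open>0 < D\<close> \<open>0 \<le> G\<close> less by (simp add: divide_less_eq less_divide_eq field_simps)
  ultimately show ?thesis using assms by (auto simp: ratio_drops_def)
qed

text \<open>
  Let \<open>v = e\<^sub>1\<close>, \<open>w = e\<^sub>1 + e\<^sub>2 + e\<^sub>3 + e\<^sub>4\<close>, and take the vectors \<open>e\<^sub>2, e\<^sub>3, e\<^sub>4\<close> together with the multiples by \<open>s\<close> of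
  \<open>w - e\<^sub>2, w - e\<^sub>3, w - e\<^sub>4\<close>. All determinants that occur are \<open>0\<close> or \<open>\<plusminus>1\<close> times a power of \<open>s\<close>, except that
  \<open>v\<close> with the last three vectors gives \<open>\<plusminus>2 * s ^ 3\<close>. With \<open>\<beta> = s powr p\<close> the four sums are
  \<open>A = 3 * \<beta> * (1 + \<beta>)\<^sup>2\<close>, \<open>D = 1 + 6 * \<beta> + 9 * \<beta>\<^sup>2 + 2 powr p * \<beta> ^ 3\<close>, \<open>E = (1 + \<beta>) ^ 3\<close> and \<open>G = 3 * (1 + \<beta>)\<^sup>2\<close>, and
  \<open>D * E < A * G\<close> amounts to \<open>1 + 2 powr p * \<beta> ^ 3 < 3 * \<beta>\<close>. For \<open>\<beta> = 1 / 2\<close> this says \<open>2 powr p < 4\<close>.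
\<close>

lemma counterexample_dim_4:
  fixes p :: real
  assumes p: "0 < p" "p < 2"
  shows "\<exists>v us ws. ratio_drops 4 p v us ws"
proof -
  define s :: real where "s = (1 / 2) powr (1 / p)"
  have s: "0 < s" and sp: "s powr p = 1 / 2" using p by (simp_all add: s_def powr_powr)
  define v :: "real vec" where "v = vec_of_list [1, 0, 0, 0]"
  define w :: "real vec" where "w = vec_of_list [1, 1, 1, 1]"
  define us :: "real vec list" where "us = [vec_of_list [0, 1, 0, 0], vec_of_list [0, 0, 1, 0],
    vec_of_list [0, 0, 0, 1], vec_of_list [s, 0, s, s], vec_of_list [s, s, 0, s], vec_of_list [s, s, s, 0]]"
  note dets = det_mat_of_cols_4 det_mat_of_cols_3 vec_of_list_index us_def v_def w_def
  have n4: "sublist_sum 4 xs F = sublist_sum (Suc (Suc (Suc (Suc 0)))) xs F"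
    "sublist_sum 3 xs F = sublist_sum (Suc (Suc (Suc 0))) xs F"
    "sublist_sum 2 xs F = sublist_sum (Suc (Suc 0)) xs F" for xs and F :: "real vec list \<Rightarrow> real"
    by (simp_all add: eval_nat_numeral)
  have A: "sublist_sum 4 us (\<lambda>l. \<bar>det (mat_of_cols 4 l)\<bar> powr p) = 27 / 8"
    unfolding n4 us_def sublist_sum.simps
    using s by (simp add: dets abs_mult powr_mult sp del: vec_of_list_Cons)
  have D: "sublist_sum 3 us (\<lambda>l. \<bar>det (mat_of_cols 4 (v # l))\<bar> powr p) = 25 / 4 + 2 powr p / 8"
    unfolding n4 us_def sublist_sum.simps
    using s by (simp add: dets abs_mult powr_mult sp del: vec_of_list_Cons)
  have E: "sublist_sum 3 us (\<lambda>l. \<bar>det (mat_of_cols 4 (l @ [w]))\<bar> powr p) = 27 / 8"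
    unfolding n4 us_def sublist_sum.simps
    using s by (simp add: dets abs_mult powr_mult sp del: vec_of_list_Cons)
  have G: "sublist_sum 2 us (\<lambda>l. \<bar>det (mat_of_cols 4 (v # l @ [w]))\<bar> powr p) = 27 / 4"
    unfolding n4 us_def sublist_sum.simps
    using s by (simp add: dets abs_mult powr_mult sp del: vec_of_list_Cons)
  have "2 powr p < 2 powr 2" using p by (intro powr_less_mono) auto
  hence two: "2 powr p < 4" by simp
  have "ratio_drops 4 p v us [w]"
  proof (rule ratio_drops_snocI[OF _ _ _ _ _ _ A D E G])
    have dim: "vec_of_list xs \<in> carrier_vec 4" if "length xs = 4" for xs :: "real list"
      using that by (intro carrier_vecI) simp
    have "v \<bullet> v = 1"
      by (simp only: v_def vec_of_list_Cons scalar_prod_vCons) (simp add: scalar_prod_def)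
    then show "v \<in> unit_sphere 4"
      by (simp add: unit_sphere_def v_def dim del: vec_of_list_Cons)
    show "set us \<subseteq> carrier_vec 4" by (simp add: us_def dim del: vec_of_list_Cons)
    show "w \<in> carrier_vec 4" by (simp add: w_def dim del: vec_of_list_Cons)
    show "(25 / 4 + 2 powr p / 8) * (27 / 8) < 27 / 8 * (27 / 4 :: real)" using two by simp
  qed (simp_all add: us_def add_pos_pos del: vec_of_list_Cons)
  thus ?thesis by blast
qed

text \<open>
  For small \<open>e\<close> the left-hand side exceeds \<open>2 + 2 * e powr p\<close> by a term of order \<open>e\<^sup>2\<close> only, while \<open>p < 2\<close> makes
  the gain \<open>(2 powr p - 2) * e powr p\<close> of larger order.
\<close>

lemma ex_scale_beating_bernoulli:
  fixes p :: real
  assumes p: "1 < p" "p < 2"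
  shows "\<exists>e. 0 < e \<and> e < 1 \<and> (1 + e) powr p + (1 - e) powr p + 2 * e powr p < 2 + (2 * e) powr p"
proof -
  have "2 powr 1 < 2 powr p" "2 powr p < 2 powr 2" using p by (intro powr_less_mono; simp)+
  hence two: "2 < 2 powr p" "2 powr p < 4" by simp_all
  \<comment> \<open>Chosen such that \<open>e powr (2 - p) = c\<close> turns \<open>p * e\<^sup>2\<close> into half of the gain.\<close>
  define c where "c = (2 powr p - 2) / (2 * p)"
  have c: "0 < c" "c < 1" using two p by (simp_all add: c_def divide_less_eq)
  define e where "e = c powr (1 / (2 - p))"
  have e: "0 < e" "e < 1"
    using c p powr_less_mono2[of "1 / (2 - p)" c 1] by (simp_all add: e_def)
  have "e powr (2 - p) = c" using c p by (simp add: e_def powr_powr)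
  moreover have "e\<^sup>2 = e powr p * e powr (2 - p)" using e by (simp flip: powr_add)
  ultimately have "p * e\<^sup>2 = e powr p * (p * c)" by simp
  also have "p * c = (2 powr p - 2) / 2" using p by (simp add: c_def)
  also have "e powr p * ((2 powr p - 2) / 2) < e powr p * (2 powr p - 2)" using e two by simp
  also have "\<dots> = (2 * e) powr p - 2 * e powr p" using e by (simp add: powr_mult algebra_simps)
  finally have small: "p * e\<^sup>2 < (2 * e) powr p - 2 * e powr p" .
  \<comment> \<open>The square makes the linear terms in \<open>e\<close> cancel.\<close>
  have bern: "x powr p \<le> 1 + p / 2 * (x\<^sup>2 - 1)" if "0 < x" for x
  proof -
    have "x powr p = (x\<^sup>2) powr (p / 2)" using that by (simp add: powr_powr flip: powr_numeral)
    also have "\<dots> \<le> 1 + p / 2 * (x\<^sup>2 - 1)" using powr_le_tangent[of "x\<^sup>2" 1 "p / 2"] p by simp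
    finally show ?thesis .
  qed
  have "(1 + e) powr p + (1 - e) powr p \<le> 2 + p * e\<^sup>2"
    using bern[of "1 + e"] bern[of "1 - e"] e by (simp add: power2_eq_square algebra_simps)
  with small e show ?thesis by (intro exI[of _ e]) auto
qed

text \<open>
  In affine coordinates, the unit masses at the corners of the unit square give equality for every exponent: the
  coordinates are independent, and the area bound is sharp. A fifth point \<open>(e, - e)\<close> of
  small mass \<open>\<tau>\<close> changes the difference \<open>A * G - D * E\<close> by \<open>4 * \<tau> * \<delta>\<close> to first order, where
  \<open>\<delta> = 2 + (2 * e) powr p - 2 * e powr p - (1 + e) powr p - (1 - e) powr p\<close> is positive for a suitable \<open>e\<close>. The mass enters by
  scaling the vector \<open>(e, - e, 1)\<close> with \<open>s = \<tau> powr (1 / p)\<close>.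
\<close>

lemma counterexample_dim_3:
  fixes p :: real
  assumes p: "1 < p" "p < 2"
  shows "\<exists>v us ws. ratio_drops 3 p v us ws"
proof -
  obtain e where e: "0 < e" "e < 1"
    and gap: "(1 + e) powr p + (1 - e) powr p + 2 * e powr p < 2 + (2 * e) powr p"
    using ex_scale_beating_bernoulli[OF p] by blast
  define \<alpha> where "\<alpha> = 2 * e powr p + 2 * (1 - e) powr p"
  define \<beta> where "\<beta> = 2 * e powr p + 2 * (1 + e) powr p"
  define \<sigma> where "\<sigma> = 1 + 2 * e powr p + (1 - e) powr p + (1 + e) powr p + (2 * e) powr p"
  define \<delta> where "\<delta> = 1 + \<sigma> - \<alpha> - \<beta>"
  have nn: "0 \<le> \<alpha>" "0 \<le> \<beta>" "0 \<le> \<sigma>" by (simp_all add: \<alpha>_def \<beta>_def \<sigma>_def)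
  have \<delta>: "0 < \<delta>" using gap by (simp add: \<delta>_def \<alpha>_def \<beta>_def \<sigma>_def)
  \<comment> \<open>So small that the term of second order in \<open>\<tau>\<close>, at least \<open>- \<tau>\<^sup>2 * \<alpha> * \<beta>\<close>, is beaten by the first.\<close>
  define \<tau> where "\<tau> = \<delta> / (1 + \<alpha> * \<beta>)"
  have ab: "0 < 1 + \<alpha> * \<beta>" using nn by (simp add: add_pos_nonneg)
  have \<tau>: "0 < \<tau>" using \<delta> ab by (simp add: \<tau>_def)
  define s where "s = \<tau> powr (1 / p)"
  have s: "0 < s" and sp: "s powr p = \<tau>" using p \<tau> by (simp_all add: s_def powr_powr)
  define v :: "real vec" where "v = vec_of_list [1, 0, 0]"
  define w :: "real vec" where "w = vec_of_list [0, 1, 0]"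
  define us :: "real vec list" where "us = [vec_of_list [0, 0, 1], vec_of_list [1, 0, 1],
    vec_of_list [0, 1, 1], vec_of_list [1, 1, 1], vec_of_list [s * e, - (s * e), s]]"
  have n3: "sublist_sum 3 xs F = sublist_sum (Suc (Suc (Suc 0))) xs F"
    "sublist_sum 2 xs F = sublist_sum (Suc (Suc 0)) xs F" for xs and F :: "real vec list \<Rightarrow> real"
    by (simp_all add: eval_nat_numeral)
  have s_rules: "\<bar>s\<bar> powr p = \<tau>" "\<bar>s * e\<bar> powr p = \<tau> * e powr p" "\<bar>s * (1 - e)\<bar> powr p = \<tau> * (1 - e) powr p"
    "\<bar>s * (1 + e)\<bar> powr p = \<tau> * (1 + e) powr p" "\<bar>s * (2 * e)\<bar> powr p = \<tau> * (2 * e) powr p"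
    using s e sp by (simp_all add: abs_mult powr_mult)
  have norm: "s - s * e = s * (1 - e)" "s * e - s = - (s * (1 - e))" "s + s * e = s * (1 + e)" "s * e + s = s * (1 + e)"
    "- s - s * e = - (s * (1 + e))" "- (s * e) - s = - (s * (1 + e))" "s * e + s * e = s * (2 * e)"
    "- (s * e) - s * e = - (s * (2 * e))" "s * (1 + e) - s * e = s" "s * (1 + e) - s * (2 * e) = s * (1 - e)"
    "- (s * (1 - e)) - s * (2 * e) = - (s * (1 + e))"
    by (simp_all add: algebra_simps)
  have expand: "\<tau> * \<sigma> = \<tau> + 2 * (\<tau> * e powr p) + \<tau> * (1 - e) powr p + \<tau> * (1 + e) powr p + \<tau> * (2 * e) powr p"
    "\<tau> * \<alpha> = 2 * (\<tau> * e powr p) + 2 * (\<tau> * (1 - e) powr p)"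
    "\<tau> * \<beta> = 2 * (\<tau> * e powr p) + 2 * (\<tau> * (1 + e) powr p)"
    by (simp_all add: \<sigma>_def \<alpha>_def \<beta>_def algebra_simps)
  note dets = det_mat_of_cols_3 vec_of_list_index us_def v_def w_def
  have A: "sublist_sum 3 us (\<lambda>l. \<bar>det (mat_of_cols 3 l)\<bar> powr p) = 4 + \<tau> * \<sigma>"
    unfolding n3 us_def sublist_sum.simps
    by (simp add: dets norm s_rules expand del: vec_of_list_Cons)
  have D: "sublist_sum 2 us (\<lambda>l. \<bar>det (mat_of_cols 3 (v # l))\<bar> powr p) = 4 + \<tau> * \<beta>"
    unfolding n3 us_def sublist_sum.simps
    by (simp add: dets norm s_rules expand del: vec_of_list_Cons)
  have E: "sublist_sum 2 us (\<lambda>l. \<bar>det (mat_of_cols 3 (l @ [w]))\<bar> powr p) = 4 + \<tau> * \<alpha>"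
    unfolding n3 us_def sublist_sum.simps
    by (simp add: dets norm s_rules expand del: vec_of_list_Cons)
  have G: "sublist_sum 1 us (\<lambda>l. \<bar>det (mat_of_cols 3 (v # l @ [w]))\<bar> powr p) = 4 + \<tau>"
    unfolding us_def sublist_sum.simps One_nat_def
    by (simp add: dets norm s_rules expand del: vec_of_list_Cons)
  have "\<tau> * (\<alpha> * \<beta>) \<le> \<delta>" using \<delta> ab nn by (simp add: \<tau>_def divide_le_eq mult_left_mono)
  moreover have "0 \<le> \<tau> * \<sigma>" using \<tau> nn by simp
  ultimately have "0 < \<tau> * (4 * \<delta> + \<tau> * \<sigma> - \<tau> * (\<alpha> * \<beta>))" using \<delta> \<tau> by (intro mult_pos_pos) auto
  hence less: "(4 + \<tau> * \<beta>) * (4 + \<tau> * \<alpha>) < (4 + \<tau> * \<sigma>) * (4 + \<tau>)"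
    by (simp add: \<delta>_def algebra_simps)
  have "ratio_drops 3 p v us [w]"
  proof (rule ratio_drops_snocI[OF _ _ _ _ _ _ A D E G])
    have dim: "vec_of_list xs \<in> carrier_vec 3" if "length xs = 3" for xs :: "real list"
      using that by (intro carrier_vecI) simp
    have "v \<bullet> v = 1"
      by (simp only: v_def vec_of_list_Cons scalar_prod_vCons) (simp add: scalar_prod_def)
    then show "v \<in> unit_sphere 3"
      by (simp add: unit_sphere_def v_def dim del: vec_of_list_Cons)
    show "set us \<subseteq> carrier_vec 3" by (simp add: us_def dim del: vec_of_list_Cons)
    show "w \<in> carrier_vec 3" by (simp add: w_def dim del: vec_of_list_Cons)
    show "(4 + \<tau> * \<beta>) * (4 + \<tau> * \<alpha>) < (4 + \<tau> * \<sigma>) * (4 + \<tau>)" by (rule less)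
    show "0 < 4 + \<tau> * \<beta>" using \<tau> nn by (simp add: add_pos_nonneg)
  qed (use \<tau> in \<open>simp_all add: us_def del: vec_of_list_Cons\<close>)
  thus ?thesis by blast
qed

theorem theorem4:
  shows
    "(\<forall>p::real. 0 < p \<and> p < 1 \<longrightarrow>
        (\<forall>N' N (u :: nat \<Rightarrow> real vec) v.
           1 \<le> N' \<and> N' \<le> N \<and> (\<forall>m\<in>{1..N}. u m \<in> carrier_vec 3) \<and> v \<in> unit_sphere 3 \<longrightarrow>
           det_ratio 3 u v p 1 N \<ge> det_ratio 3 u v p 1 N'))
     \<and> (\<forall>n\<ge>3. \<forall>p::real. 1 < p \<and> p < 2 \<longrightarrow>
        (\<exists>N' N (u :: nat \<Rightarrow> real vec) v.
           1 \<le> N' \<and> N' \<le> N \<and> (\<forall>m\<in>{1..N}. u m \<in> carrier_vec n) \<and> v \<in> unit_sphere n \<and>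
           \<not> det_ratio n u v p 1 N \<ge> det_ratio n u v p 1 N'))
     \<and> (\<forall>n\<ge>4. \<forall>p::real. 0 < p \<and> p < 1 \<longrightarrow>
        (\<exists>N' N (u :: nat \<Rightarrow> real vec) v.
           1 \<le> N' \<and> N' \<le> N \<and> (\<forall>m\<in>{1..N}. u m \<in> carrier_vec n) \<and> v \<in> unit_sphere n \<and>
           \<not> det_ratio n u v p 1 N \<ge> det_ratio n u v p 1 N'))"
proof (intro conjI allI impI; (elim conjE)?)
  fix p :: real and N' N :: nat and u :: "nat \<Rightarrow> real vec" and v
  assume "0 < p" "p < 1" "1 \<le> N'" "N' \<le> N" "\<forall>m\<in>{1..N}. u m \<in> carrier_vec 3" "v \<in> unit_sphere 3"
  then show "det_ratio 3 u v p 1 N \<ge> det_ratio 3 u v p 1 N'" by (intro det_ratio_3_mono) auto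
next
  fix n :: nat and p :: real
  assume n: "3 \<le> n" and p: "1 < p" "p < 2"
  obtain v us ws where "ratio_drops 3 p v us ws" using counterexample_dim_3[OF p] by blast
  then obtain v us ws where "ratio_drops n p v us ws" using ratio_drops_all_dims[of 3 p v us ws n] n by auto
  then show "\<exists>N' N (u :: nat \<Rightarrow> real vec) v.
      1 \<le> N' \<and> N' \<le> N \<and> (\<forall>m\<in>{1..N}. u m \<in> carrier_vec n) \<and> v \<in> unit_sphere n \<and>
      \<not> det_ratio n u v p 1 N \<ge> det_ratio n u v p 1 N'"
    by (rule ratio_drops_det_ratio)
next
  fix n :: nat and p :: real
  assume n: "4 \<le> n" and p: "0 < p" "p < 1"
  have "p < 2" using p by simp
  with p obtain v us ws where "ratio_drops 4 p v us ws" using counterexample_dim_4[of p] by blast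
  then obtain v us ws where "ratio_drops n p v us ws" using ratio_drops_all_dims[of 4 p v us ws n] n by auto
  then show "\<exists>N' N (u :: nat \<Rightarrow> real vec) v.
      1 \<le> N' \<and> N' \<le> N \<and> (\<forall>m\<in>{1..N}. u m \<in> carrier_vec n) \<and> v \<in> unit_sphere n \<and>
      \<not> det_ratio n u v p 1 N \<ge> det_ratio n u v p 1 N'"
    by (rule ratio_drops_det_ratio)
qed

end
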